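(* Let $d\ge 1$, let $\omega$ be a weight function and let $\psi\in\mathcal{S}_\omega(\mathbb{R}^d)\setminus\{0\}$. Then the synthesis operator $$D_\psi:\ \tilde\Lambda_\omega\longrightarrow\mathcal{S}_\omega(\mathbb{R}^d),\qquad D_\psi c=\sum_{k,n\in\mathbb{Z}^d}c_{(\alpha_0k,\beta_0n)}\,\Pi(\alpha_0k,\beta_0n)\psi,$$ is (well defined and) continuous.
   Context: A weight function is a continuous increasing function $\omega:[0,+\infty)\to[0,+\infty)$ such that: $(\alpha)$ there is $L\ge 1$ with $\omega(2t)\le L(\omega(t)+1)$ for all $t\ge 0$; $(\beta)$ $\omega(t)=o(t)$ as $t\to+\infty$; $(\gamma)$ there are $a\in\mathbb{R}$, $b>0$ with $\omega(t)\ge a+b\log(1+t)$ for all $t\ge 0$; $(\delta)$ the map $t\mapsto\omega(e^t)$ is convex. For a vector $\zeta$ one writes $\omega(\zeta):=\omega(|\zeta|)$, with $|\cdot|$ the Euclidean norm. The Fourier transform is $\hat u(\xi)=\int_{\mathbb{R}^d}u(x)e^{-i\langle x,\xi\rangle}dx$. The space $\mathcal{S}_\omega(\mathbb{R}^d)$ is the set of all $u\in L^1(\mathbb{R}^d)$ such that $u,\hat u\in C^\infty(\mathbb{R}^d)$ and, for each $\lambda>0$ and each $\alpha\in\mathbb{N}_0^d$, $\sup_{x}e^{\lambda\omega(x)}|\partial^\alpha u(x)|<+\infty$ and $\sup_{\xi}e^{\lambda\omega(\xi)}|\partial^\alpha\hat u(\xi)|<+\infty$. It carries the Fréchet topology given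 by these seminorms. For $z=(x,\xi)\in\mathbb{R}^{2d}$, $\Pi(z)f(y)=e^{i\langle y,\xi\rangle}f(y-x)$. Throughout, $\Lambda=\alpha_0\mathbb{Z}^d\times\beta_0\mathbb{Z}^d$, where $\alpha_0,\beta_0>0$ are fixed so that $\{\Pi(\sigma)\varphi_0\}_{\sigma\in\Lambda}$ is a Gabor frame for $L^2(\mathbb{R}^d)$, with $\varphi_0(x)=e^{-|x|^2}$. $\tilde\Lambda_\omega$ is the Fréchet space of all complex families $c=(c_\sigma)_{\sigma\in\Lambda}$ such that $\|c\|_k:=\sup_{\sigma\in\Lambda}|c_\sigma|e^{k\omega(\sigma)}<+\infty$ for all $k\in\mathbb{N}$, with the topology given by the norms $\|\cdot\|_k$. *)

theory Defs
  imports "HOL-Analysis.Analysis" "HOL-Library.Landau_Symbols"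
begin

text \<open>Only the values of \<open>\<omega>\<close> on \<open>[0,\<infinity>)\<close> matter. ``Increasing'' is read in the weak sense.\<close>

definition weight_function :: "(real \<Rightarrow> real) \<Rightarrow> bool" where
  "weight_function \<omega> \<longleftrightarrow>
     continuous_on {0..} \<omega> \<and> mono_on {0..} \<omega> \<and> (\<forall>t\<ge>0. 0 \<le> \<omega> t) \<and>
     (\<exists>L\<ge>1. \<forall>t\<ge>0. \<omega> (2 * t) \<le> L * (\<omega> t + 1)) \<and>
     \<omega> \<in> o[at_top](\<lambda>t. t) \<and>
     (\<exists>a b. b > 0 \<and> (\<forall>t\<ge>0. \<omega> t \<ge> a + b * ln (1 + t))) \<and>
     convex_on UNIV (\<lambda>t. \<omega> (exp t))"

definition partial_deriv :: "'d::finite \<Rightarrow> (real^'d \<Rightarrow> complex) \<Rightarrow> real^'d \<Rightarrow> complex" where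
  "partial_deriv i f x = vector_derivative (\<lambda>t. f (x + t *\<^sub>R axis i 1)) (at 0)"

primrec C_k :: "nat \<Rightarrow> (real^'d::finite \<Rightarrow> complex) \<Rightarrow> bool" where
  "C_k 0 f \<longleftrightarrow> continuous_on UNIV f"
| "C_k (Suc k) f \<longleftrightarrow> (\<forall>x. f differentiable (at x)) \<and> (\<forall>i. C_k k (partial_deriv i f))"

definition C_infinity :: "(real^'d::finite \<Rightarrow> complex) \<Rightarrow> bool" where
  "C_infinity f \<longleftrightarrow> (\<forall>k. C_k k f)"

text \<open>
  \<open>\<partial>\<^sup>\<alpha>\<close> for a multi-index \<open>\<alpha>\<close>. The index type carries no order, so the order in which the coordinate
  derivatives are taken is fixed by an arbitrary enumeration of the coordinates; by Schwarz's
  theorem it is irrelevant for \<open>C\<^sup>\<infinity>\<close> functions, the only ones this is used for.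
\<close>

definition coords :: "'d::finite list" where
  "coords = (SOME is. distinct is \<and> set is = UNIV)"

definition mderiv :: "nat^'d::finite \<Rightarrow> (real^'d \<Rightarrow> complex) \<Rightarrow> real^'d \<Rightarrow> complex" where
  "mderiv \<alpha> f = foldr (\<lambda>i. partial_deriv i ^^ (\<alpha> $ i)) coords f"

definition fourier :: "(real^'d::finite \<Rightarrow> complex) \<Rightarrow> real^'d \<Rightarrow> complex" where
  "fourier u \<xi> = (LINT x|lborel. u x * exp (- \<i> * complex_of_real (x \<bullet> \<xi>)))"

definition S_space :: "(real \<Rightarrow> real) \<Rightarrow> (real^'d::finite \<Rightarrow> complex) set" where
  "S_space \<omega> = {u. integrable lborel u \<and> C_infinity u \<and> C_infinity (fourier u) \<and>
     (\<forall>\<mu>>0. \<forall>\<alpha>.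
        bdd_above (range (\<lambda>x. exp (\<mu> * \<omega> (norm x)) * cmod (mderiv \<alpha> u x))) \<and>
        bdd_above (range (\<lambda>\<xi>. exp (\<mu> * \<omega> (norm \<xi>)) * cmod (mderiv \<alpha> (fourier u) \<xi>))))}"

definition S_seminorm :: "(real \<Rightarrow> real) \<Rightarrow> real \<Rightarrow> nat^'d::finite \<Rightarrow> (real^'d \<Rightarrow> complex) \<Rightarrow> real" where
  "S_seminorm \<omega> \<mu> \<alpha> u = (SUP x. exp (\<mu> * \<omega> (norm x)) * cmod (mderiv \<alpha> u x))"

text \<open>
  The topology on \<open>V\<close> determined by a family \<open>P\<close> of seminorms on \<open>V\<close>. On function spaces the
  difference \<open>v - u\<close> is the pointwise one.
\<close>

definition seminorm_topology :: "'v::minus set \<Rightarrow> ('v \<Rightarrow> real) set \<Rightarrow> 'v topology" where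
  "seminorm_topology V P =
     topology_generated_by {{v \<in> V. p (v - u) < \<epsilon>} | u p \<epsilon>. u \<in> V \<and> p \<in> P \<and> \<epsilon> > 0}"

definition S_topology :: "(real \<Rightarrow> real) \<Rightarrow> (real^'d::finite \<Rightarrow> complex) topology" where
  "S_topology \<omega> = seminorm_topology (S_space \<omega>)
     ({S_seminorm \<omega> \<mu> \<alpha> | \<mu> \<alpha>. \<mu> > 0} \<union> {\<lambda>u. S_seminorm \<omega> \<mu> \<alpha> (fourier u) | \<mu> \<alpha>. \<mu> > 0})"

definition tf_shift ::
  "(real^'d::finite) \<times> (real^'d) \<Rightarrow> (real^'d \<Rightarrow> complex) \<Rightarrow> real^'d \<Rightarrow> complex" where
  "tf_shift z f y = exp (\<i> * complex_of_real (y \<bullet> snd z)) * f (y - fst z)"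

definition lattice_point :: "real \<Rightarrow> real \<Rightarrow> (int^'d::finite) \<times> (int^'d) \<Rightarrow> (real^'d) \<times> (real^'d)" where
  "lattice_point \<alpha>\<^sub>0 \<beta>\<^sub>0 = (\<lambda>(k, n). (\<chi> i. \<alpha>\<^sub>0 * of_int (k $ i), \<chi> i. \<beta>\<^sub>0 * of_int (n $ i)))"

definition lattice :: "real \<Rightarrow> real \<Rightarrow> ((real^'d::finite) \<times> (real^'d)) set" where
  "lattice \<alpha>\<^sub>0 \<beta>\<^sub>0 = range (lattice_point \<alpha>\<^sub>0 \<beta>\<^sub>0)"

text \<open>Elements of \<open>L\<^sup>2\<close> are represented by Borel functions.\<close>

definition square_integrable :: "(real^'d::finite \<Rightarrow> complex) \<Rightarrow> bool" where
  "square_integrable f \<longleftrightarrow>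
     f \<in> borel_measurable lborel \<and> integrable lborel (\<lambda>x. (cmod (f x))\<^sup>2)"

definition L2_inner :: "(real^'d::finite \<Rightarrow> complex) \<Rightarrow> (real^'d \<Rightarrow> complex) \<Rightarrow> complex" where
  "L2_inner f g = (LINT x|lborel. f x * cnj (g x))"

definition gabor_frame :: "(real^'d::finite \<Rightarrow> complex) \<Rightarrow> ((real^'d) \<times> (real^'d)) set \<Rightarrow> bool" where
  "gabor_frame g \<Lambda> \<longleftrightarrow> square_integrable g \<and>
     (\<exists>A B. 0 < A \<and> 0 < B \<and> (\<forall>f. square_integrable f \<longrightarrow>
        (\<lambda>\<sigma>. (cmod (L2_inner f (tf_shift \<sigma> g)))\<^sup>2) summable_on \<Lambda> \<and>
        A * (LINT x|lborel. (cmod (f x))\<^sup>2) \<le> (\<Sum>\<^sub>\<infinity>\<sigma>\<in>\<Lambda>. (cmod (L2_inner f (tf_shift \<sigma> g)))\<^sup>2) \<and>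
        (\<Sum>\<^sub>\<infinity>\<sigma>\<in>\<Lambda>. (cmod (L2_inner f (tf_shift \<sigma> g)))\<^sup>2) \<le> B * (LINT x|lborel. (cmod (f x))\<^sup>2)))"

definition gaussian :: "real^'d::finite \<Rightarrow> complex" where
  "gaussian x = complex_of_real (exp (- (norm x)\<^sup>2))"

text \<open>
  A family \<open>(c\<^sub>\<sigma>)\<close> indexed by \<open>\<sigma> \<in> \<Lambda>\<close> is encoded as a function on the whole space that vanishes off
  \<open>\<Lambda>\<close>. The norm on the product type is the Euclidean norm of \<open>\<real>\<^sup>2\<^sup>d\<close>.
\<close>

definition seq_space ::
  "(real \<Rightarrow> real) \<Rightarrow> ((real^'d::finite) \<times> (real^'d)) set \<Rightarrow> ((real^'d) \<times> (real^'d) \<Rightarrow> complex) set" where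
  "seq_space \<omega> \<Lambda> = {c. (\<forall>\<sigma>. \<sigma> \<notin> \<Lambda> \<longrightarrow> c \<sigma> = 0) \<and>
     (\<forall>k::nat. bdd_above ((\<lambda>\<sigma>. cmod (c \<sigma>) * exp (real k * \<omega> (norm \<sigma>))) ` \<Lambda>))}"

definition seq_norm ::
  "(real \<Rightarrow> real) \<Rightarrow> ((real^'d::finite) \<times> (real^'d)) set \<Rightarrow> nat \<Rightarrow> ((real^'d) \<times> (real^'d) \<Rightarrow> complex) \<Rightarrow> real" where
  "seq_norm \<omega> \<Lambda> k c = (SUP \<sigma>\<in>\<Lambda>. cmod (c \<sigma>) * exp (real k * \<omega> (norm \<sigma>)))"

definition seq_topology ::
  "(real \<Rightarrow> real) \<Rightarrow> ((real^'d::finite) \<times> (real^'d)) set \<Rightarrow> ((real^'d) \<times> (real^'d) \<Rightarrow> complex) topology" where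
  "seq_topology \<omega> \<Lambda> = seminorm_topology (seq_space \<omega> \<Lambda>) (range (seq_norm \<omega> \<Lambda>))"

definition synthesis_partial ::
  "real \<Rightarrow> real \<Rightarrow> (real^'d::finite \<Rightarrow> complex) \<Rightarrow> ((real^'d) \<times> (real^'d) \<Rightarrow> complex)
     \<Rightarrow> ((int^'d) \<times> (int^'d)) set \<Rightarrow> real^'d \<Rightarrow> complex" where
  "synthesis_partial \<alpha>\<^sub>0 \<beta>\<^sub>0 \<psi> c F y =
     (\<Sum>kn\<in>F. c (lattice_point \<alpha>\<^sub>0 \<beta>\<^sub>0 kn) * tf_shift (lattice_point \<alpha>\<^sub>0 \<beta>\<^sub>0 kn) \<psi> y)"

text \<open>
  The candidate sum, taken pointwise; it is the sum of the series in \<open>\<S>\<^sub>\<omega>\<close> as soon as the finite partial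
  sums converge to it in \<open>S_topology\<close>.
\<close>

definition synthesis ::
  "real \<Rightarrow> real \<Rightarrow> (real^'d::finite \<Rightarrow> complex) \<Rightarrow> ((real^'d) \<times> (real^'d) \<Rightarrow> complex)
     \<Rightarrow> real^'d \<Rightarrow> complex" where
  "synthesis \<alpha>\<^sub>0 \<beta>\<^sub>0 \<psi> c y =
     (\<Sum>\<^sub>\<infinity>kn\<in>UNIV. c (lattice_point \<alpha>\<^sub>0 \<beta>\<^sub>0 kn) * tf_shift (lattice_point \<alpha>\<^sub>0 \<beta>\<^sub>0 kn) \<psi> y)"

lemma topspace_seminorm_topology:
  fixes V :: "('a \<Rightarrow> complex) set"
  assumes "p \<in> P" "p (\<lambda>_. 0) = 0"
  shows "topspace (seminorm_topology V P) = V"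
proof -
  have "u \<in> \<Union>{{v \<in> V. p (v - u) < \<epsilon>} | u p \<epsilon>. u \<in> V \<and> p \<in> P \<and> \<epsilon> > 0}" if "u \<in> V" for u
  proof (rule UnionI)
    show "{v \<in> V. p (v - u) < 1} \<in> {{v \<in> V. p (v - u) < \<epsilon>} | u p \<epsilon>. u \<in> V \<and> p \<in> P \<and> \<epsilon> > 0}"
      using that assms(1) zero_less_one by blast
    show "u \<in> {v \<in> V. p (v - u) < 1}"
      using that assms(2) by (simp add: fun_diff_def)
  qed
  then show ?thesis
    unfolding seminorm_topology_def topology_generated_by_topspace by blast
qed

lemma topspace_seq_topology: "topspace (seq_topology \<omega> (lattice \<alpha>\<^sub>0 \<beta>\<^sub>0)) = seq_space \<omega> (lattice \<alpha>\<^sub>0 \<beta>\<^sub>0)"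
  unfolding seq_topology_def
  by (rule topspace_seminorm_topology[where p = "seq_norm \<omega> (lattice \<alpha>\<^sub>0 \<beta>\<^sub>0) 0"])
     (auto simp: seq_norm_def lattice_def)

lemma mderiv_zero: "mderiv \<alpha> (\<lambda>_. 0) = (\<lambda>_. 0)"
proof -
  have pd: "partial_deriv i (\<lambda>_. 0) = (\<lambda>_. 0)" for i :: 'a
    by (simp add: partial_deriv_def fun_eq_iff)
  have "(partial_deriv i ^^ n) (\<lambda>_. 0) = (\<lambda>_. 0)" for i :: 'a and n
    by (induction n) (simp_all add: pd)
  then have "foldr (\<lambda>i. partial_deriv i ^^ (\<alpha> $ i)) is (\<lambda>_. 0) = (\<lambda>_. 0)" for "is"
    by (induction "is") simp_all
  then show ?thesis by (simp add: mderiv_def)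
qed

lemma topspace_S_topology: "topspace (S_topology \<omega>) = S_space \<omega>"
  unfolding S_topology_def
proof (rule topspace_seminorm_topology)
  show "S_seminorm \<omega> 1 0 \<in> {S_seminorm \<omega> \<mu> \<alpha> |\<mu> \<alpha>. 0 < \<mu>} \<union> {\<lambda>u. S_seminorm \<omega> \<mu> \<alpha> (fourier u) |\<mu> \<alpha>. 0 < \<mu>}"
    using zero_less_one by blast
  show "S_seminorm \<omega> 1 0 (\<lambda>_. 0) = 0"
    by (simp add: S_seminorm_def mderiv_zero)
qed

end

theory Submission
  imports Defs
begin

text \<open>Write \<open>\<Pi>(z) \<psi>\<close> for \<open>tf_shift z \<psi>\<close>. Everything rests on one estimate: for every seminorm of \<open>S_space \<omega>\<close> the
  value at \<open>\<Pi>(z) \<psi>\<close> is at most \<open>C exp (K \<omega>(|z|))\<close>, with \<open>C\<close> and \<open>K\<close> independent of \<open>z\<close>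
  (\<open>tf_shift_bound\<close>). The translation part costs such a factor because \<open>\<omega>\<close> is subadditive up to
  constants (from the doubling condition), and each derivative that falls on the modulation costs one coordinate
  of the frequency, which is again at most \<open>C exp (K \<omega>(|z|))\<close> because \<open>\<omega>\<close> dominates a multiple of the logarithm.
  The same lower bound on \<open>\<omega>\<close> makes \<open>exp (- N \<omega>(|\<sigma>|))\<close> summable over the lattice for large \<open>N\<close>
  (\<open>summable_on_lattice_weight\<close>). Consequently a seminorm of \<open>c\<^sub>\<sigma> \<Pi>(\<sigma>) \<psi>\<close>, summed over \<open>\<sigma>\<close>, is at most a
  constant times the sequence norm of \<open>c\<close> of order \<open>K + N\<close>. Convergence of the series and the continuity of
  the operator both follow, the operator being linear.

  The seminorms on the Fourier side need no second argument. The transform of \<open>\<Pi>(x, \<xi>) \<psi>\<close> is a phase times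
  \<open>\<Pi>(\<xi>, -x)\<close> applied to the transform of \<open>\<psi>\<close>, so the transform of a synthesized function is itself a
  synthesized function (\<open>fourier_synth_dual\<close>), with coefficients of the same modulus, points of the same
  norm, and a window that satisfies the same bounds.

  Two pieces of analysis support this. The space is defined by the derivatives \<open>mderiv\<close>, taken in one fixed order
  of the coordinates, whereas smoothness of an infinite sum requires differentiating it in every order;
  Schwarz's theorem (\<open>partial_deriv_commute\<close>) identifies the two kinds of derivatives. Termwise
  differentiation of a dominated series (\<open>C_infinity_infsum_dominated\<close>, \<open>iter_deriv_infsum_dominated\<close>)
  then transfers the bounds from the terms to the sum.\<close>

section \<open>Iterated partial derivatives\<close>

text \<open>Lists of coordinates describe iterated derivatives in an arbitrary order. The innermost derivative is the head
  of the list, so that induction on the list with \<open>f\<close> arbitrary replaces \<open>f\<close> by a partial derivative of \<open>f\<close>.\<close>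

definition iter_deriv :: "'d::finite list \<Rightarrow> (real^'d \<Rightarrow> complex) \<Rightarrow> real^'d \<Rightarrow> complex" where
  "iter_deriv is f = fold partial_deriv is f"

lemma iter_deriv_Nil [simp]: "iter_deriv [] f = f"
  and iter_deriv_Cons [simp]: "iter_deriv (i # is) f = iter_deriv is (partial_deriv i f)"
  and iter_deriv_append: "iter_deriv (is @ js) f = iter_deriv js (iter_deriv is f)"
  by (simp_all add: iter_deriv_def)

lemma has_vector_derivative_partial_deriv:
  assumes "f differentiable (at (x + s *\<^sub>R axis i 1))"
  shows "((\<lambda>t. f (x + t *\<^sub>R axis i 1)) has_vector_derivative partial_deriv i f (x + s *\<^sub>R axis i 1)) (at s)"
proof -
  obtain f' where f': "(f has_derivative f') (at (x + s *\<^sub>R axis i 1))"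
    using assms by (auto simp: differentiable_def)
  have lin: "linear f'" using f' has_derivative_linear by blast
  have line: "((\<lambda>t. f (y + t *\<^sub>R axis i 1)) has_vector_derivative f' (axis i 1)) (at r)"
    if "y + r *\<^sub>R axis i 1 = x + s *\<^sub>R axis i 1" for y r
  proof -
    have "((\<lambda>t. y + t *\<^sub>R axis i (1::real)) has_derivative (\<lambda>t. t *\<^sub>R axis i 1)) (at r)"
      by (auto intro!: derivative_eq_intros)
    from has_derivative_compose[OF this] f' that
    have "((\<lambda>t. f (y + t *\<^sub>R axis i 1)) has_derivative (\<lambda>t. f' (t *\<^sub>R axis i 1))) (at r)"
      by simp
    then show ?thesis
      by (simp add: has_vector_derivative_def linear_scale[OF lin])
  qed
  have "partial_deriv i f (x + s *\<^sub>R axis i 1) = f' (axis i 1)"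
    unfolding partial_deriv_def by (rule vector_derivative_at, rule line) simp
  with line show ?thesis by simp
qed

lemma partial_deriv_eqI:
  assumes "(f has_derivative f') (at x)"
  shows "partial_deriv i f x = f' (axis i 1)"
proof -
  have lin: "linear f'" using assms has_derivative_linear by blast
  have "((\<lambda>t. x + t *\<^sub>R axis i (1::real)) has_derivative (\<lambda>t. t *\<^sub>R axis i 1)) (at 0)"
    by (auto intro!: derivative_eq_intros)
  from has_derivative_compose[OF this, of f f'] assms
  have "((\<lambda>t. f (x + t *\<^sub>R axis i 1)) has_vector_derivative f' (axis i 1)) (at 0)"
    by (simp add: has_vector_derivative_def linear_scale[OF lin])
  then show ?thesis
    unfolding partial_deriv_def by (rule vector_derivative_at)
qed

lemma has_derivative_partial_deriv:
  assumes "f differentiable (at x)"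
  shows "(f has_derivative (\<lambda>h. \<Sum>i\<in>UNIV. of_real (h $ i) * partial_deriv i f x)) (at x)"
proof -
  obtain f' where f': "(f has_derivative f') (at x)"
    using assms by (auto simp: differentiable_def)
  have lin: "linear f'" using f' has_derivative_linear by blast
  have "f' h = (\<Sum>i\<in>UNIV. of_real (h $ i) * partial_deriv i f x)" for h
  proof -
    have "f' h = f' (\<Sum>i\<in>UNIV. h $ i *\<^sub>R axis i 1)"
      using basis_expansion[of h] by (simp add: scalar_mult_eq_scaleR)
    also have "\<dots> = (\<Sum>i\<in>UNIV. h $ i *\<^sub>R f' (axis i 1))"
      by (simp add: linear_sum[OF lin] linear_scale[OF lin])
    finally show ?thesis
      by (simp add: partial_deriv_eqI[OF f'] scaleR_conv_of_real)
  qed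
  then show ?thesis using f' by presburger
qed

lemma C_infinity_differentiable: "C_infinity f \<Longrightarrow> f differentiable (at x)"
  unfolding C_infinity_def by (metis C_k.simps(2))

lemma C_infinity_partial_deriv: "C_infinity f \<Longrightarrow> C_infinity (partial_deriv i f)"
  unfolding C_infinity_def by (metis C_k.simps(2))

lemma C_infinity_continuous: "C_infinity f \<Longrightarrow> continuous_on UNIV f"
  unfolding C_infinity_def by (metis C_k.simps(1))

lemma C_infinityI:
  assumes "\<And>is x. iter_deriv is f differentiable (at x)"
  shows "C_infinity f"
proof -
  have "C_k k f" for k
    using assms
  proof (induction k arbitrary: f)
    case 0
    from 0[of "[]"] have "\<And>x. f differentiable (at x)" by simp
    then show ?case
      by (auto intro!: differentiable_imp_continuous_on simp: differentiable_on_def)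
  next
    case (Suc k)
    from Suc.prems[of "[]"] have "\<And>x. f differentiable (at x)" by simp
    moreover have "C_k k (partial_deriv i f)" for i
      using Suc.prems[of "i # _"] by (intro Suc.IH) simp
    ultimately show ?case by simp
  qed
  then show ?thesis by (simp add: C_infinity_def)
qed

text \<open>The proof principle for smoothness: a class of differentiable functions that is closed under partial
  derivatives consists of smooth functions. Sums, time-frequency shifts and infinite series are handled by it.\<close>

lemma C_infinity_coinduct:
  assumes "P f"
    and "\<And>f x. P f \<Longrightarrow> f differentiable (at x)"
    and "\<And>f i. P f \<Longrightarrow> P (partial_deriv i f)"
  shows "C_infinity f"
proof (rule C_infinityI)
  fix "is" x
  have "P (iter_deriv is f)"
    using assms(1) by (induction "is" arbitrary: f) (auto intro: assms(3))
  then show "iter_deriv is f differentiable (at x)" by (rule assms(2))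
qed

lemma sum_axis: "(\<Sum>j\<in>UNIV. of_real (axis i 1 $ j) * p j) = (p i :: complex)"
proof -
  have "of_real (axis i 1 $ j) * p j = (if j = i then p j else 0)" for j
    by (simp add: axis_def)
  then show ?thesis by (simp only: sum.delta finite_class.finite_UNIV) simp
qed

lemma partial_deriv_add:
  assumes "\<And>x. f differentiable (at x)" "\<And>x. g differentiable (at x)"
  shows "partial_deriv i (\<lambda>x. f x + g x) = (\<lambda>x. partial_deriv i f x + partial_deriv i g x)"
  by (rule ext, subst partial_deriv_eqI[OF has_derivative_add],
      (rule has_derivative_partial_deriv assms)+)
     (simp add: sum_axis)

lemma partial_deriv_cmult:
  assumes "\<And>x. f differentiable (at x)"
  shows "partial_deriv i (\<lambda>x. c * f x) = (\<lambda>x. c * partial_deriv i f x)"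
  by (rule ext, subst partial_deriv_eqI[OF has_derivative_mult_right],
      (rule has_derivative_partial_deriv assms)+)
     (simp add: sum_axis)

lemma C_infinity_add:
  assumes "C_infinity f" "C_infinity g"
  shows "C_infinity (\<lambda>x. f x + g x)"
proof (rule C_infinity_coinduct[where P = "\<lambda>h. \<exists>f g. C_infinity f \<and> C_infinity g \<and> h = (\<lambda>x. f x + g x)"])
  show "\<exists>f' g'. C_infinity f' \<and> C_infinity g' \<and> (\<lambda>x. f x + g x) = (\<lambda>x. f' x + g' x)"
    using assms by blast
next
  show "\<exists>f' g'. C_infinity f' \<and> C_infinity g' \<and> partial_deriv i h = (\<lambda>x. f' x + g' x)"
    if sum: "\<exists>f g. C_infinity f \<and> C_infinity g \<and> h = (\<lambda>x. f x + g x)" for h and i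
  proof -
    obtain f g where "C_infinity f" "C_infinity g" "h = (\<lambda>x. f x + g x)" using sum by blast
    then show ?thesis
      by (intro exI[of _ "partial_deriv i f"] exI[of _ "partial_deriv i g"])
         (simp add: partial_deriv_add C_infinity_differentiable C_infinity_partial_deriv)
  qed
qed (auto intro!: differentiable_add simp: C_infinity_differentiable)

lemma C_infinity_cmult:
  assumes "C_infinity f"
  shows "C_infinity (\<lambda>x. c * f x)"
proof (rule C_infinity_coinduct[where P = "\<lambda>h. \<exists>f. C_infinity f \<and> h = (\<lambda>x. c * f x)"])
  show "\<exists>f'. C_infinity f' \<and> (\<lambda>x. c * f x) = (\<lambda>x. c * f' x)"
    using assms by blast
qed (auto simp: partial_deriv_cmult C_infinity_differentiable intro!: differentiable_mult
       intro: C_infinity_partial_deriv)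

lemma iter_deriv_add:
  assumes "C_infinity f" "C_infinity g"
  shows "iter_deriv is (\<lambda>x. f x + g x) = (\<lambda>x. iter_deriv is f x + iter_deriv is g x)"
  using assms
  by (induction "is" arbitrary: f g)
     (simp_all add: partial_deriv_add C_infinity_differentiable C_infinity_partial_deriv)

lemma iter_deriv_cmult:
  assumes "C_infinity f"
  shows "iter_deriv is (\<lambda>x. c * f x) = (\<lambda>x. c * iter_deriv is f x)"
  using assms
  by (induction "is" arbitrary: f)
     (simp_all add: partial_deriv_cmult C_infinity_differentiable C_infinity_partial_deriv)

lemma C_infinity_diff: "C_infinity f \<Longrightarrow> C_infinity g \<Longrightarrow> C_infinity (\<lambda>x. f x - g x)"
  using C_infinity_add[OF _ C_infinity_cmult[of g "-1"]] by simp

lemma iter_deriv_diff: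
  "C_infinity f \<Longrightarrow> C_infinity g \<Longrightarrow>
    iter_deriv is (\<lambda>x. f x - g x) = (\<lambda>x. iter_deriv is f x - iter_deriv is g x)"
  using iter_deriv_add[OF _ C_infinity_cmult[of g "-1"], of f "is"] iter_deriv_cmult[of g "is" "-1"]
  by simp

lemma C_infinity_zero: "C_infinity (\<lambda>x. 0)"
  by (rule C_infinity_coinduct[where P = "\<lambda>h. h = (\<lambda>x. 0)"])
     (auto simp: partial_deriv_def)

lemma iter_deriv_zero: "iter_deriv is (\<lambda>x. 0) = (\<lambda>x. 0)"
  using iter_deriv_cmult[OF C_infinity_zero, of "is" 0] by simp

lemma C_infinity_sum:
  "(\<And>j. j \<in> F \<Longrightarrow> C_infinity (f j)) \<Longrightarrow> C_infinity (\<lambda>x. \<Sum>j\<in>F. f j x)"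
  by (induction F rule: infinite_finite_induct) (auto intro: C_infinity_add C_infinity_zero)

lemma iter_deriv_sum:
  "(\<And>j. j \<in> F \<Longrightarrow> C_infinity (f j)) \<Longrightarrow>
    iter_deriv is (\<lambda>x. \<Sum>j\<in>F. f j x) = (\<lambda>x. \<Sum>j\<in>F. iter_deriv is (f j) x)"
  by (induction F rule: infinite_finite_induct)
     (simp_all add: iter_deriv_zero iter_deriv_add C_infinity_sum)

subsection \<open>Schwarz's theorem\<close>

text \<open>The second difference over the square of side \<open>h\<close> is a mixed derivative at an inner point, by the mean value
  theorem applied in one variable after the other. Exchanging the variables gives the other mixed derivative for
  the same difference, and letting \<open>h\<close> tend to \<open>0\<close> compares the two at the corner.\<close>

lemma mixed_second_difference:
  fixes g :: "real \<Rightarrow> real \<Rightarrow> real"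
  assumes g1: "\<And>s t. ((\<lambda>s. g s t) has_real_derivative g1 s t) (at s)"
    and g12: "\<And>s t. ((\<lambda>t. g1 s t) has_real_derivative g12 s t) (at t)"
    and "h > 0"
  shows "\<exists>s t. 0 < s \<and> s < h \<and> 0 < t \<and> t < h \<and> g h h - g h 0 - g 0 h + g 0 0 = h * (h * g12 s t)"
proof -
  have "\<exists>s>0. s < h \<and> (g h h - g h 0) - (g 0 h - g 0 0) = (h - 0) * (g1 s h - g1 s 0)"
    by (rule MVT2[OF \<open>h > 0\<close>, of "\<lambda>s. g s h - g s 0"]) (intro DERIV_diff g1)
  then obtain s where s: "0 < s" "s < h" "(g h h - g h 0) - (g 0 h - g 0 0) = h * (g1 s h - g1 s 0)"
    by auto
  have "\<exists>t>0. t < h \<and> g1 s h - g1 s 0 = (h - 0) * g12 s t"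
    by (rule MVT2[OF \<open>h > 0\<close>]) (rule g12)
  then obtain t where t: "0 < t" "t < h" "g1 s h - g1 s 0 = h * g12 s t"
    by auto
  have "g h h - g h 0 - g 0 h + g 0 0 = h * (h * g12 s t)"
    using s(3) unfolding t(3) by simp
  with s t show ?thesis by blast
qed

lemma mixed_partials_equal:
  fixes g :: "real \<Rightarrow> real \<Rightarrow> real"
  assumes g1: "\<And>s t. ((\<lambda>s. g s t) has_real_derivative g1 s t) (at s)"
    and g2: "\<And>s t. ((\<lambda>t. g s t) has_real_derivative g2 s t) (at t)"
    and g12: "\<And>s t. ((\<lambda>t. g1 s t) has_real_derivative g12 s t) (at t)"
    and g21: "\<And>s t. ((\<lambda>s. g2 s t) has_real_derivative g21 s t) (at s)"
    and c12: "isCont (\<lambda>p. g12 (fst p) (snd p)) (0, 0)"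
    and c21: "isCont (\<lambda>p. g21 (fst p) (snd p)) (0, 0)"
  shows "g12 0 0 = g21 0 0"
proof (rule ccontr)
  assume ne: "g12 0 0 \<noteq> g21 0 0"
  define e where "e = \<bar>g12 0 0 - g21 0 0\<bar> / 2"
  have "e > 0" using ne by (simp add: e_def)
  obtain d1 where d1: "d1 > 0" "\<And>p. dist p (0,0) < d1 \<Longrightarrow> \<bar>g12 (fst p) (snd p) - g12 0 0\<bar> < e"
    using c12 \<open>e > 0\<close> unfolding continuous_at_eps_delta by (auto simp: dist_real_def)
  obtain d2 where d2: "d2 > 0" "\<And>p. dist p (0,0) < d2 \<Longrightarrow> \<bar>g21 (fst p) (snd p) - g21 0 0\<bar> < e"
    using c21 \<open>e > 0\<close> unfolding continuous_at_eps_delta by (auto simp: dist_real_def)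
  define h where "h = min d1 d2 / 2"
  have h: "h > 0" using d1 d2 by (simp add: h_def)
  have near: "dist (s,t) (0::real,0::real) < d1 \<and> dist (s,t) (0::real,0::real) < d2"
    if "0 < s" "s < h" "0 < t" "t < h" for s t
  proof -
    have "dist (s,t) (0::real,0::real) \<le> s + t"
      using that norm_Pair_le[of s t] by (simp add: dist_norm)
    also have "\<dots> < 2 * h" using that by simp
    finally show ?thesis by (simp add: h_def)
  qed
  obtain s t where st: "0 < s" "s < h" "0 < t" "t < h"
      "g h h - g h 0 - g 0 h + g 0 0 = h * (h * g12 s t)"
    using mixed_second_difference[OF g1 g12 h] by blast
  obtain s' t' where st': "0 < s'" "s' < h" "0 < t'" "t' < h"
      "g h h - g 0 h - g h 0 + g 0 0 = h * (h * g21 s' t')"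
    using mixed_second_difference[of "\<lambda>t s. g s t", OF g2 g21 h] by blast
  have "h * (h * g12 s t) = h * (h * g21 s' t')" using st(5) st'(5) by linarith
  then have "g12 s t = g21 s' t'" using h by simp
  moreover have "\<bar>g12 s t - g12 0 0\<bar> < e" using d1(2)[of "(s,t)"] near[OF st(1-4)] by simp
  moreover have "\<bar>g21 s' t' - g21 0 0\<bar> < e" using d2(2)[of "(s',t')"] near[OF st'(1-4)] by simp
  ultimately have "\<bar>g12 0 0 - g21 0 0\<bar> < 2 * e" by linarith
  then show False by (simp add: e_def)
qed

lemma partial_deriv_commute:
  assumes f: "C_infinity f"
  shows "partial_deriv i (partial_deriv j f) = partial_deriv j (partial_deriv i f)"
proof
  fix x
  define X :: "real \<Rightarrow> real \<Rightarrow> real^'a" where "X s t = x + s *\<^sub>R axis i 1 + t *\<^sub>R axis j 1" for s t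
  have X': "X s t = x + t *\<^sub>R axis j 1 + s *\<^sub>R axis i 1" for s t by (simp add: X_def)
  have along_i: "((\<lambda>s. g (X s t)) has_vector_derivative partial_deriv i g (X s t)) (at s)"
    if "C_infinity g" for g s t
    unfolding X' by (rule has_vector_derivative_partial_deriv) (rule C_infinity_differentiable[OF that])
  have along_j: "((\<lambda>t. g (X s t)) has_vector_derivative partial_deriv j g (X s t)) (at t)"
    if "C_infinity g" for g s t
    unfolding X_def by (rule has_vector_derivative_partial_deriv) (rule C_infinity_differentiable[OF that])
  have cont: "isCont (\<lambda>p. g (X (fst p) (snd p))) (0,0)" if "C_infinity g" for g :: "real^'a \<Rightarrow> complex"
  proof -
    have "continuous_on UNIV (\<lambda>p. g (X (fst p) (snd p)))"
      unfolding X_def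
      by (rule continuous_on_compose2[OF C_infinity_continuous[OF that]]) (auto intro!: continuous_intros)
    then show ?thesis by (simp add: continuous_on_eq_continuous_at)
  qed
  \<comment> \<open>The mean value theorem is
    about real functions, so it is applied to the components of \<open>f\<close> along \<open>w = 1\<close> and \<open>w = \<i>\<close>.\<close>
  have *: "partial_deriv j (partial_deriv i f) x \<bullet> w = partial_deriv i (partial_deriv j f) x \<bullet> w" for w
  proof -
    have inn: "((\<lambda>s. q s \<bullet> w) has_real_derivative (q' \<bullet> w)) (at r)"
      if "(q has_vector_derivative q') (at r)" for q :: "real \<Rightarrow> complex" and q' r
      using bounded_linear.has_vector_derivative[OF bounded_linear_inner_left that]
      by (simp add: has_real_derivative_iff_has_vector_derivative)
    have "(\<lambda>s t. partial_deriv j (partial_deriv i f) (X s t) \<bullet> w) 0 0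
        = (\<lambda>s t. partial_deriv i (partial_deriv j f) (X s t) \<bullet> w) 0 0"
    proof (rule mixed_partials_equal[where g = "\<lambda>s t. f (X s t) \<bullet> w"
          and ?g1.0 = "\<lambda>s t. partial_deriv i f (X s t) \<bullet> w"
          and ?g2.0 = "\<lambda>s t. partial_deriv j f (X s t) \<bullet> w"
          and ?g12.0 = "\<lambda>s t. partial_deriv j (partial_deriv i f) (X s t) \<bullet> w"
          and ?g21.0 = "\<lambda>s t. partial_deriv i (partial_deriv j f) (X s t) \<bullet> w"])
    qed (intro inn along_i along_j f C_infinity_partial_deriv isCont_inner cont continuous_const)+
    then show ?thesis by (simp add: X_def)
  qed
  show "partial_deriv i (partial_deriv j f) x = partial_deriv j (partial_deriv i f) x"
    using *[of 1] *[of \<i>] by (intro complex_eqI) (simp_all add: inner_complex_def)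
qed

lemma iter_deriv_remove1:
  assumes "C_infinity f" "i \<in> set is"
  shows "iter_deriv is f = iter_deriv (remove1 i is) (partial_deriv i f)"
  using assms
  by (induction "is" arbitrary: f)
     (auto simp: C_infinity_partial_deriv partial_deriv_commute[of _ i])

lemma iter_deriv_cong_mset:
  assumes "C_infinity f" "mset is = mset js"
  shows "iter_deriv is f = iter_deriv js f"
  using assms
proof (induction "is" arbitrary: f js)
  case (Cons i "is")
  have i: "i \<in> set js" using Cons.prems(2) by (metis list.set_intros(1) mset_eq_setD)
  then have "mset is = mset (remove1 i js)"
    by (metis Cons.prems(2) mset_remove1 remove1.simps(2))
  with Cons i show ?case by (simp add: iter_deriv_remove1 C_infinity_partial_deriv)
qed simp

lemma coords: "distinct (coords :: 'd::finite list)" "set (coords :: 'd list) = UNIV"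
proof -
  have "\<exists>is :: 'd list. distinct is \<and> set is = UNIV"
    using finite_distinct_list[of "UNIV :: 'd set"] by auto
  then have "distinct (coords :: 'd list) \<and> set (coords :: 'd list) = UNIV"
    unfolding coords_def by (rule someI_ex)
  then show "distinct (coords :: 'd list)" "set (coords :: 'd list) = UNIV" by auto
qed

lemma mderiv_eq_iter_deriv:
  "mderiv \<alpha> f = iter_deriv (concat (map (\<lambda>i. replicate (\<alpha> $ i) i) (rev coords))) f"
proof -
  have pow: "(partial_deriv i ^^ n) g = iter_deriv (replicate n i) g" for i :: 'a and n g
    by (induction n arbitrary: g) (simp_all add: funpow_Suc_right del: funpow.simps(2))
  have "foldr (\<lambda>i. partial_deriv i ^^ (\<alpha> $ i)) is f
      = iter_deriv (concat (map (\<lambda>i. replicate (\<alpha> $ i) i) (rev is))) f" for "is"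
    by (induction "is") (simp_all add: iter_deriv_append pow)
  then show ?thesis by (simp add: mderiv_def)
qed

text \<open>The multiset of a list determines the iterated derivative, and the multi-index that counts the entries of the
  list yields, along \<open>coords\<close>, a list with the same multiset.\<close>

lemma iter_deriv_eq_mderiv:
  fixes f :: "real^'d::finite \<Rightarrow> complex"
  assumes "C_infinity f"
  shows "iter_deriv is f = mderiv (\<chi> i. count_list is i) f"
proof -
  have count: "count (mset (concat (map (\<lambda>i. replicate (count_list is i) i) js))) i
      = (if i \<in> set js then count_list is i else 0)" if "distinct js" for js and i :: 'd
    using that by (induction js) auto
  have "mset is = mset (concat (map (\<lambda>i. replicate (count_list is i) i) (rev coords)))"
    by (rule multiset_eqI, subst count) (simp_all add: coords count_mset)
  from iter_deriv_cong_mset[OF assms this] show ?thesis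
    by (simp add: mderiv_eq_iter_deriv)
qed

section \<open>Series of rapidly decreasing functions\<close>

text \<open>This condition is imposed on a function and on its Fourier transform in \<open>S_space\<close>. Stating it with
  derivatives in every order makes it stable under partial derivatives by definition; the equivalence with
  \<open>mderiv\<close> below is where Schwarz's theorem enters.\<close>

definition rapidly_decreasing :: "(real \<Rightarrow> real) \<Rightarrow> (real^'d::finite \<Rightarrow> complex) \<Rightarrow> bool" where
  "rapidly_decreasing \<omega> f \<longleftrightarrow> C_infinity f \<and>
     (\<forall>\<mu>>0. \<forall>is. \<exists>B. \<forall>x. exp (\<mu> * \<omega> (norm x)) * cmod (iter_deriv is f x) \<le> B)"

lemma rapidly_decreasing_iff_mderiv:
  "rapidly_decreasing \<omega> f \<longleftrightarrow> C_infinity f \<and>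
     (\<forall>\<mu>>0. \<forall>\<alpha>. bdd_above (range (\<lambda>x. exp (\<mu> * \<omega> (norm x)) * cmod (mderiv \<alpha> f x))))"
proof (cases "C_infinity f")
  case True
  have "(\<forall>is. Q (iter_deriv is f)) \<longleftrightarrow> (\<forall>\<alpha>. Q (mderiv \<alpha> f))" for Q :: "(real^'a \<Rightarrow> complex) \<Rightarrow> bool"
  proof (intro iffI allI)
    show "Q (iter_deriv is f)" if "\<forall>\<alpha>. Q (mderiv \<alpha> f)" for "is"
      using that by (simp add: iter_deriv_eq_mderiv[OF True])
    show "Q (mderiv \<alpha> f)" if "\<forall>is. Q (iter_deriv is f)" for \<alpha>
      using that by (simp add: mderiv_eq_iter_deriv)
  qed
  then have "(\<forall>is. \<exists>B. \<forall>x. exp (\<mu> * \<omega> (norm x)) * cmod (iter_deriv is f x) \<le> B) \<longleftrightarrow>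
      (\<forall>\<alpha>. \<exists>B. \<forall>x. exp (\<mu> * \<omega> (norm x)) * cmod (mderiv \<alpha> f x) \<le> B)" for \<mu>
    by this
  then show ?thesis by (auto simp: rapidly_decreasing_def bdd_above_def)
qed (simp add: rapidly_decreasing_def)

lemma S_space_iff:
  "u \<in> S_space \<omega> \<longleftrightarrow>
     integrable lborel u \<and> rapidly_decreasing \<omega> u \<and> rapidly_decreasing \<omega> (fourier u)"
  unfolding S_space_def rapidly_decreasing_iff_mderiv by auto

text \<open>Termwise differentiation and termwise integration are carried out for sequences. This lemma reduces
  unordered sums over a countable index type to that case: the index type is embedded into the natural numbers and the gaps
  are filled with zeros, which also covers finite index types.\<close>

lemma sums_to_nat:
  fixes f :: "'j::countable \<Rightarrow> 'b::{comm_monoid_add,t2_space}"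
  assumes "(f has_sum s) UNIV"
  shows "(\<lambda>n. if n \<in> range (to_nat :: 'j \<Rightarrow> nat) then f (from_nat n) else 0) sums s"
proof -
  have "((\<lambda>n. f (from_nat n)) has_sum s) (range (to_nat :: 'j \<Rightarrow> nat))"
    by (subst has_sum_reindex) (use assms in \<open>auto simp: o_def inj_on_def\<close>)
  then have "((\<lambda>n. if n \<in> range (to_nat :: 'j \<Rightarrow> nat) then f (from_nat n) else 0) has_sum s) UNIV"
    by (subst has_sum_cong_neutral[where T = "range to_nat" and g = "\<lambda>n. f (from_nat n)"]) auto
  then show ?thesis by (rule has_sum_imp_sums)
qed

lemma
  fixes f :: "'j \<Rightarrow> 'b::banach"
  assumes B: "B summable_on J" and le: "\<And>j. j \<in> J \<Longrightarrow> norm (f j) \<le> B j"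
  shows dominated_summable_on: "f summable_on J"
    and norm_infsum_dominated: "norm (infsum f J) \<le> infsum B J"
proof -
  have abs: "f abs_summable_on J"
    by (rule summable_on_comparison_test[OF B]) (simp_all add: le)
  show "f summable_on J" by (rule abs_summable_summable[OF abs])
  have "norm (infsum f J) \<le> (\<Sum>\<^sub>\<infinity>j\<in>J. norm (f j))" by (rule norm_infsum_bound[OF abs])
  also have "\<dots> \<le> infsum B J" by (rule infsum_mono[OF abs B]) (rule le)
  finally show "norm (infsum f J) \<le> infsum B J" .
qed

lemma norm_sums_tail_le:
  fixes p :: "nat \<Rightarrow> 'b::banach"
  assumes "p sums P" "b sums \<beta>" "\<And>n. norm (p n) \<le> b n"
  shows "norm ((\<Sum>n<N. p n) - P) \<le> \<beta> - (\<Sum>n<N. b n)"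
proof -
  have "(\<lambda>n. p (n + N)) sums (P - (\<Sum>n<N. p n))" "(\<lambda>n. b (n + N)) sums (\<beta> - (\<Sum>n<N. b n))"
    using assms(1,2) by (simp_all add: sums_iff_shift)
  then have "norm (P - (\<Sum>n<N. p n)) \<le> \<beta> - (\<Sum>n<N. b n)"
    by (rule norm_sums_le) (rule assms(3))
  then show ?thesis by (simp add: norm_minus_commute)
qed

text \<open>The total derivatives of the partial sums converge uniformly relative to the norm of the increment \<open>h\<close>:
  each coordinate contributes at most \<open>norm h\<close> times the tail of its dominating series, uniformly in \<open>x\<close>.\<close>

lemma infsum_differentiable:
  fixes f :: "'j::countable \<Rightarrow> real^'d \<Rightarrow> complex"
  assumes diff: "\<And>j x. f j differentiable (at x)"
    and A: "A summable_on UNIV" "\<And>j x. cmod (f j x) \<le> A j"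
    and B: "\<And>i. B i summable_on UNIV" "\<And>i j x. cmod (partial_deriv i (f j) x) \<le> B i j"
  shows "(\<lambda>x. \<Sum>\<^sub>\<infinity>j. f j x) differentiable (at x)"
    and "partial_deriv i (\<lambda>x. \<Sum>\<^sub>\<infinity>j. f j x) x = (\<Sum>\<^sub>\<infinity>j. partial_deriv i (f j) x)"
proof -
  let ?R = "range (to_nat :: 'j \<Rightarrow> nat)"
  define F where "F n x = (if n \<in> ?R then f (from_nat n) x else 0)" for n x
  define p where "p n i x = (if n \<in> ?R then partial_deriv i (f (from_nat n)) x else 0)" for n i x
  define b where "b n i = (if n \<in> ?R then B i (from_nat n) else 0)" for n i
  define P where "P i x = (\<Sum>\<^sub>\<infinity>j. partial_deriv i (f j) x)" for i x
  define T where "T i N = infsum (B i) UNIV - (\<Sum>n<N. b n i)" for i N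
  have F: "(\<lambda>n. F n x) sums (\<Sum>\<^sub>\<infinity>j. f j x)" for x
    unfolding F_def
    by (rule sums_to_nat, rule has_sum_infsum, rule dominated_summable_on[OF A(1)]) (rule A(2))
  have p: "(\<lambda>n. p n i x) sums P i x" for i x
    unfolding p_def P_def
    by (rule sums_to_nat, rule has_sum_infsum, rule dominated_summable_on[OF B(1)]) (rule B(2))
  have b: "(\<lambda>n. b n i) sums infsum (B i) UNIV" for i
    unfolding b_def by (intro sums_to_nat has_sum_infsum B)
  have pb: "cmod (p n i x) \<le> b n i" for n i x
    by (simp add: p_def b_def B)
  have tail: "cmod ((\<Sum>n<N. p n i x) - P i x) \<le> T i N" for i x N
    unfolding T_def by (rule norm_sums_tail_le[OF p b pb])
  have T_lim: "(\<lambda>N. \<Sum>i\<in>UNIV. T i N) \<longlonglongrightarrow> (\<Sum>i\<in>(UNIV::'d set). infsum (B i) UNIV - infsum (B i) UNIV)"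
    unfolding T_def by (intro tendsto_sum tendsto_diff tendsto_const) (use b in \<open>simp add: sums_def\<close>)
  have deriv: "(F n has_derivative (\<lambda>h. \<Sum>i\<in>UNIV. of_real (h $ i) * p n i x)) (at x within UNIV)" for n x
  proof (cases "n \<in> ?R")
    case True
    then have "F n = f (from_nat n)" by (simp add: F_def fun_eq_iff)
    then show ?thesis
      using True has_derivative_partial_deriv[OF diff[of "from_nat n" x]] by (simp add: p_def)
  next
    case False
    then have "F n = (\<lambda>x. 0)" by (simp add: F_def fun_eq_iff)
    with False show ?thesis by (simp add: p_def)
  qed
  have unif: "\<forall>\<^sub>F N in sequentially. \<forall>x\<in>UNIV. \<forall>h. norm ((\<Sum>n<N. \<Sum>i\<in>UNIV. of_real (h $ i) * p n i x)
        - (\<Sum>i\<in>UNIV. of_real (h $ i) * P i x)) \<le> e * norm h" if "e > 0" for e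
  proof -
    have "\<forall>\<^sub>F N in sequentially. (\<Sum>i\<in>UNIV. T i N) < e"
      using order_tendstoD(2)[OF T_lim, of e] that by simp
    then show ?thesis
    proof (rule eventually_mono, intro ballI allI)
      fix N x and h :: "real^'d"
      assume N: "(\<Sum>i\<in>UNIV. T i N) < e"
      have "(\<Sum>n<N. \<Sum>i\<in>UNIV. of_real (h $ i) * p n i x) - (\<Sum>i\<in>UNIV. of_real (h $ i) * P i x)
          = (\<Sum>i\<in>UNIV. of_real (h $ i) * ((\<Sum>n<N. p n i x) - P i x))"
        by (subst sum.swap) (simp add: sum_distrib_left sum_subtractf right_diff_distrib)
      also have "norm \<dots> \<le> (\<Sum>i\<in>UNIV. norm h * T i N)"
        by (rule sum_norm_le)
           (auto simp: norm_mult intro!: mult_mono tail component_le_norm_cart)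
      also have "\<dots> = (\<Sum>i\<in>UNIV. T i N) * norm h" by (simp add: sum_distrib_left mult.commute)
      also have "\<dots> \<le> e * norm h" using N by (intro mult_right_mono) auto
      finally show "norm ((\<Sum>n<N. \<Sum>i\<in>UNIV. of_real (h $ i) * p n i x)
        - (\<Sum>i\<in>UNIV. of_real (h $ i) * P i x)) \<le> e * norm h" .
    qed
  qed
  obtain g where g: "\<And>x. (\<lambda>n. F n x) sums g x"
      "\<And>x. (g has_derivative (\<lambda>h. \<Sum>i\<in>UNIV. of_real (h $ i) * P i x)) (at x)"
    using has_derivative_series[OF convex_UNIV deriv unif UNIV_I F] by auto
  have "g = (\<lambda>x. \<Sum>\<^sub>\<infinity>j. f j x)"
    using g(1) F sums_unique2 by blast
  with g(2) have D: "((\<lambda>x. \<Sum>\<^sub>\<infinity>j. f j x) has_derivative (\<lambda>h. \<Sum>i\<in>UNIV. of_real (h $ i) * P i x)) (at x)"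
    by simp
  then show "(\<lambda>x. \<Sum>\<^sub>\<infinity>j. f j x) differentiable (at x)"
    by (auto simp: differentiable_def)
  show "partial_deriv i (\<lambda>x. \<Sum>\<^sub>\<infinity>j. f j x) x = (\<Sum>\<^sub>\<infinity>j. partial_deriv i (f j) x)"
    unfolding partial_deriv_eqI[OF D] sum_axis by (simp add: P_def)
qed

text \<open>The family version of smoothness for which differentiation under the sum can be repeated: it passes to the
  family of partial derivatives.\<close>

definition dominated_family :: "('j \<Rightarrow> real^'d::finite \<Rightarrow> complex) \<Rightarrow> bool" where
  "dominated_family f \<longleftrightarrow> (\<forall>j. C_infinity (f j)) \<and>
     (\<forall>is. \<exists>B. B summable_on UNIV \<and> (\<forall>j x. cmod (iter_deriv is (f j) x) \<le> B j))"

lemma dominated_family_partial_deriv: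
  assumes "dominated_family f"
  shows "dominated_family (\<lambda>j. partial_deriv i (f j))"
  unfolding dominated_family_def
proof (intro conjI allI)
  show "C_infinity (partial_deriv i (f j))" for j
    using assms by (auto simp: dominated_family_def intro: C_infinity_partial_deriv)
  show "\<exists>B. B summable_on UNIV \<and> (\<forall>j x. cmod (iter_deriv is (partial_deriv i (f j)) x) \<le> B j)" for "is"
    using assms unfolding dominated_family_def by (metis iter_deriv_Cons)
qed

lemma
  fixes f :: "'j::countable \<Rightarrow> real^'d \<Rightarrow> complex"
  assumes "dominated_family f"
  shows differentiable_infsum_dominated: "(\<lambda>x. \<Sum>\<^sub>\<infinity>j. f j x) differentiable (at x)"
    and partial_deriv_infsum_dominated:
      "partial_deriv i (\<lambda>x. \<Sum>\<^sub>\<infinity>j. f j x) = (\<lambda>x. \<Sum>\<^sub>\<infinity>j. partial_deriv i (f j) x)"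
proof -
  have dom: "\<exists>B. B summable_on UNIV \<and> (\<forall>j x. cmod (iter_deriv is (f j) x) \<le> B j)" for "is"
    using assms by (simp add: dominated_family_def)
  obtain A where A: "A summable_on UNIV" "\<And>j x. cmod (f j x) \<le> A j"
    using dom[of "[]"] by auto
  have "\<exists>B. \<forall>i. B i summable_on UNIV \<and> (\<forall>j x. cmod (partial_deriv i (f j) x) \<le> B i j)"
    using dom[of "[_]"] by (intro choice allI) simp
  then obtain B where B: "\<And>i. B i summable_on UNIV" "\<And>i j x. cmod (partial_deriv i (f j) x) \<le> B i j"
    by auto
  have diff: "f j differentiable (at x)" for j x
    using assms by (auto simp: dominated_family_def intro: C_infinity_differentiable)
  show "(\<lambda>x. \<Sum>\<^sub>\<infinity>j. f j x) differentiable (at x)"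
    by (rule infsum_differentiable[OF diff A B])
  show "partial_deriv i (\<lambda>x. \<Sum>\<^sub>\<infinity>j. f j x) = (\<lambda>x. \<Sum>\<^sub>\<infinity>j. partial_deriv i (f j) x)"
    by (rule ext) (rule infsum_differentiable[OF diff A B])
qed

lemma C_infinity_infsum_dominated:
  fixes f :: "'j::countable \<Rightarrow> real^'d \<Rightarrow> complex"
  assumes "dominated_family f"
  shows "C_infinity (\<lambda>x. \<Sum>\<^sub>\<infinity>j. f j x)"
proof (rule C_infinity_coinduct[where
      P = "\<lambda>g. \<exists>f :: 'j \<Rightarrow> real^'d \<Rightarrow> complex. dominated_family f \<and> g = (\<lambda>x. \<Sum>\<^sub>\<infinity>j. f j x)"])
  show "\<exists>f'::'j \<Rightarrow> real^'d \<Rightarrow> complex. dominated_family f' \<and> (\<lambda>x. \<Sum>\<^sub>\<infinity>j. f j x) = (\<lambda>x. \<Sum>\<^sub>\<infinity>j. f' j x)"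
    using assms by blast
  show "\<exists>f'::'j \<Rightarrow> real^'d \<Rightarrow> complex. dominated_family f' \<and> partial_deriv i g = (\<lambda>x. \<Sum>\<^sub>\<infinity>j. f' j x)"
    if "\<exists>f::'j \<Rightarrow> real^'d \<Rightarrow> complex. dominated_family f \<and> g = (\<lambda>x. \<Sum>\<^sub>\<infinity>j. f j x)" for g i
    using that dominated_family_partial_deriv partial_deriv_infsum_dominated by blast
qed (auto intro: differentiable_infsum_dominated)

lemma iter_deriv_infsum_dominated:
  fixes f :: "'j::countable \<Rightarrow> real^'d \<Rightarrow> complex"
  assumes "dominated_family f"
  shows "iter_deriv is (\<lambda>x. \<Sum>\<^sub>\<infinity>j. f j x) = (\<lambda>x. \<Sum>\<^sub>\<infinity>j. iter_deriv is (f j) x)"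
  using assms
  by (induction "is" arbitrary: f)
     (simp_all add: partial_deriv_infsum_dominated dominated_family_partial_deriv)

context
  fixes \<omega> :: "real \<Rightarrow> real" and f :: "'j::countable \<Rightarrow> real^'d \<Rightarrow> complex"
    and B :: "real \<Rightarrow> 'd list \<Rightarrow> 'j \<Rightarrow> real"
  assumes \<omega>_nonneg: "\<And>t. t \<ge> 0 \<Longrightarrow> \<omega> t \<ge> 0"
    and smooth: "\<And>j. C_infinity (f j)"
    and summable: "\<And>\<mu> is. \<mu> > 0 \<Longrightarrow> B \<mu> is summable_on UNIV"
    and bound: "\<And>\<mu> is j x. \<mu> > 0 \<Longrightarrow> exp (\<mu> * \<omega> (norm x)) * cmod (iter_deriv is (f j) x) \<le> B \<mu> is j"
begin

lemma unweighted_bound: "cmod (iter_deriv is (f j) x) \<le> B 1 is j"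
proof -
  \<comment> \<open>Any positive weight does; \<open>\<omega> \<ge> 0\<close> makes its factor at least \<open>1\<close>.\<close>
  have "1 * cmod (iter_deriv is (f j) x) \<le> exp (1 * \<omega> (norm x)) * cmod (iter_deriv is (f j) x)"
    using \<omega>_nonneg[of "norm x"] by (intro mult_right_mono) auto
  also have "\<dots> \<le> B 1 is j" by (rule bound) simp
  finally show ?thesis by simp
qed

lemma dominated_family_weighted: "dominated_family f"
  unfolding dominated_family_def using smooth summable[of 1] unweighted_bound by (meson zero_less_one)

text \<open>The factor \<open>exp (\<mu> * \<omega> (norm x))\<close> does not depend on the summation index, so it can be moved inside the
  tail of the series and absorbed by the bound on each term. The empty \<open>F\<close> gives the estimate of the whole sum.\<close>

lemma weighted_tail_bound:
  assumes "finite F" "\<mu> > 0"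
  shows "exp (\<mu> * \<omega> (norm x)) * cmod (iter_deriv is (\<lambda>x. (\<Sum>\<^sub>\<infinity>j. f j x) - (\<Sum>j\<in>F. f j x)) x)
    \<le> infsum (B \<mu> is) (- F)"
proof -
  note dom = dominated_family_weighted
  have summ: "(\<lambda>j. iter_deriv is (f j) x) summable_on UNIV"
    by (rule dominated_summable_on[OF summable[of 1 "is"]]) (simp_all add: unweighted_bound)
  have "iter_deriv is (\<lambda>x. (\<Sum>\<^sub>\<infinity>j. f j x) - (\<Sum>j\<in>F. f j x)) x
      = (\<Sum>\<^sub>\<infinity>j. iter_deriv is (f j) x) - (\<Sum>j\<in>F. iter_deriv is (f j) x)"
    by (simp add: iter_deriv_diff C_infinity_infsum_dominated dom C_infinity_sum smooth
        iter_deriv_infsum_dominated iter_deriv_sum)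
  also have "\<dots> = (\<Sum>\<^sub>\<infinity>j\<in>-F. iter_deriv is (f j) x)"
    using infsum_Diff[OF summ, of F] assms(1) by (simp add: Compl_eq_Diff_UNIV)
  finally have "exp (\<mu> * \<omega> (norm x)) * cmod (iter_deriv is (\<lambda>x. (\<Sum>\<^sub>\<infinity>j. f j x) - (\<Sum>j\<in>F. f j x)) x)
      = cmod (\<Sum>\<^sub>\<infinity>j\<in>-F. of_real (exp (\<mu> * \<omega> (norm x))) * iter_deriv is (f j) x)"
    by (simp add: infsum_cmult_right' norm_mult)
  also have "\<dots> \<le> infsum (B \<mu> is) (- F)"
    by (rule norm_infsum_dominated)
       (simp_all add: summable_on_subset_banach[OF summable[OF assms(2)]] bound[OF assms(2)] norm_mult)
  finally show ?thesis .
qed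

lemma rapidly_decreasing_infsum: "rapidly_decreasing \<omega> (\<lambda>x. \<Sum>\<^sub>\<infinity>j. f j x)"
  unfolding rapidly_decreasing_def
  using C_infinity_infsum_dominated[OF dominated_family_weighted]
    weighted_tail_bound[OF finite.emptyI] by auto

end

section \<open>Weights\<close>

lemma weight_nonneg: "weight_function \<omega> \<Longrightarrow> t \<ge> 0 \<Longrightarrow> \<omega> t \<ge> 0"
  by (simp add: weight_function_def)

lemma weight_mono: "weight_function \<omega> \<Longrightarrow> 0 \<le> s \<Longrightarrow> s \<le> t \<Longrightarrow> \<omega> s \<le> \<omega> t"
  by (auto simp: weight_function_def mono_on_def)

text \<open>The sum of two numbers is at most twice the larger one, so the doubling condition gives subadditivity up to a
  factor and an additive constant.\<close>

lemma weight_triangle: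
  assumes "weight_function \<omega>"
  obtains L where "L \<ge> 1" "\<And>s t. s \<ge> 0 \<Longrightarrow> t \<ge> 0 \<Longrightarrow> \<omega> (s + t) \<le> L * (\<omega> s + \<omega> t + 1)"
proof -
  obtain L where L: "L \<ge> 1" "\<And>t. t \<ge> 0 \<Longrightarrow> \<omega> (2 * t) \<le> L * (\<omega> t + 1)"
    using assms by (auto simp: weight_function_def)
  have "\<omega> (s + t) \<le> L * (\<omega> s + \<omega> t + 1)" if "s \<ge> 0" "t \<ge> 0" for s t
  proof -
    have "\<omega> (s + t) \<le> \<omega> (2 * max s t)"
      using that by (intro weight_mono[OF assms]) auto
    also have "\<dots> \<le> L * (\<omega> (max s t) + 1)" using that by (intro L) auto
    also have "\<dots> \<le> L * (\<omega> s + \<omega> t + 1)"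
      using L(1) weight_nonneg[OF assms] that by (intro mult_left_mono) (auto simp: max_def)
    finally show ?thesis .
  qed
  with L(1) show ?thesis by (rule that)
qed

text \<open>This is the logarithmic lower bound, exponentiated. The exponent is rounded up to a natural
  number because the sequence norms are indexed by natural numbers.\<close>

lemma weight_dominates_powers:
  assumes "weight_function \<omega>"
  obtains C and K :: nat where "C \<ge> 0" "\<And>t. t \<ge> 0 \<Longrightarrow> 1 + t \<le> C * exp (real K * \<omega> t)"
proof -
  obtain a b where ab: "b > 0" "\<And>t. t \<ge> 0 \<Longrightarrow> \<omega> t \<ge> a + b * ln (1 + t)"
    using assms by (auto simp: weight_function_def)
  define K where "K = nat \<lceil>1 / b\<rceil>"
  have K: "1 / b \<le> real K" by (simp add: K_def real_nat_ceiling_ge)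
  have "1 + t \<le> exp (- a / b) * exp (real K * \<omega> t)" if "t \<ge> 0" for t
  proof -
    have "ln (1 + t) \<le> (\<omega> t - a) / b"
      using ab(2)[OF that] ab(1) by (simp add: field_simps)
    also have "\<dots> = - a / b + 1 / b * \<omega> t" by (simp add: diff_divide_distrib)
    also have "\<dots> \<le> - a / b + real K * \<omega> t"
      using K weight_nonneg[OF assms that] by (intro add_left_mono mult_right_mono)
    finally have "exp (ln (1 + t)) \<le> exp (- a / b + real K * \<omega> t)" by (simp only: exp_le_cancel_iff)
    then show ?thesis using that by (simp only: exp_add) simp
  qed
  then show ?thesis by (intro that[of "exp (- a / b)" K]) auto
qed

section \<open>Time-frequency shifts\<close>

lemma norm_tf_shift: "cmod (tf_shift z f y) = cmod (f (y - fst z))"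
  by (simp add: tf_shift_def norm_mult)

lemma has_derivative_modulation:
  "((\<lambda>y. exp (\<i> * complex_of_real (y \<bullet> b))) has_derivative
     (\<lambda>h. \<i> * complex_of_real (h \<bullet> b) * exp (\<i> * complex_of_real (y \<bullet> b)))) (at y)"
proof -
  have "((\<lambda>y. complex_of_real (y \<bullet> b)) has_derivative (\<lambda>h. complex_of_real (h \<bullet> b))) (at y)"
    by (auto intro!: derivative_eq_intros)
  then have "((\<lambda>y. \<i> * complex_of_real (y \<bullet> b)) has_derivative (\<lambda>h. \<i> * complex_of_real (h \<bullet> b))) (at y)"
    by (rule has_derivative_mult_right)
  from has_derivative_compose[OF this has_field_derivative_imp_has_derivative[OF DERIV_exp]]
  show ?thesis by (simp add: mult_ac)
qed

lemma
  fixes f :: "real^'d \<Rightarrow> complex"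
  assumes "\<And>x. f differentiable (at x)"
  shows differentiable_tf_shift: "tf_shift z f differentiable (at x)"
    and partial_deriv_tf_shift: "partial_deriv i (tf_shift z f) =
      tf_shift z (\<lambda>y. partial_deriv i f y + \<i> * complex_of_real (snd z $ i) * f y)"
proof -
  let ?b = "snd z" and ?a = "fst z"
  have D: "(tf_shift z f has_derivative (\<lambda>h.
      exp (\<i> * complex_of_real (y \<bullet> ?b)) * (\<Sum>i\<in>UNIV. of_real (h $ i) * partial_deriv i f (y - ?a)) +
      \<i> * complex_of_real (h \<bullet> ?b) * exp (\<i> * complex_of_real (y \<bullet> ?b)) * f (y - ?a))) (at y)" for y
  proof -
    have "((\<lambda>y. y - ?a) has_derivative (\<lambda>h. h)) (at y)"
      by (auto intro!: derivative_eq_intros)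
    from has_derivative_compose[OF this has_derivative_partial_deriv[OF assms]]
    have "((\<lambda>y. f (y - ?a)) has_derivative
        (\<lambda>h. \<Sum>i\<in>UNIV. of_real (h $ i) * partial_deriv i f (y - ?a))) (at y)" .
    from has_derivative_mult[OF has_derivative_modulation this]
    show ?thesis unfolding tf_shift_def[abs_def] .
  qed
  then show "tf_shift z f differentiable (at x)" by (auto simp: differentiable_def)
  show "partial_deriv i (tf_shift z f) =
      tf_shift z (\<lambda>y. partial_deriv i f y + \<i> * complex_of_real (snd z $ i) * f y)"
    unfolding partial_deriv_eqI[OF D, THEN ext] sum_axis
    by (simp add: tf_shift_def fun_eq_iff inner_axis' algebra_simps)
qed

lemma tf_shift_add_cmult:
  "tf_shift z (\<lambda>y. f y + c * g y) = (\<lambda>y. tf_shift z f y + c * tf_shift z g y)"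
  by (simp add: tf_shift_def fun_eq_iff algebra_simps)

text \<open>A partial derivative of a shifted function is the shift of a single new function, namely of
  \<open>\<partial>\<^sub>i f\<close> plus \<open>\<i> \<xi>\<^sub>i f\<close>. Shifts by a fixed \<open>z\<close> are therefore closed under partial derivatives.\<close>

lemma C_infinity_tf_shift:
  assumes "C_infinity f"
  shows "C_infinity (tf_shift z f)"
proof (rule C_infinity_coinduct[where P = "\<lambda>h. \<exists>f. C_infinity f \<and> h = tf_shift z f"])
  show "\<exists>f'. C_infinity f' \<and> tf_shift z f = tf_shift z f'" using assms by blast
next
  fix h i
  assume "\<exists>f. C_infinity f \<and> h = tf_shift z f"
  then obtain f where f: "C_infinity f" "h = tf_shift z f" by blast
  have "C_infinity (\<lambda>y. partial_deriv i f y + \<i> * complex_of_real (snd z $ i) * f y)"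
    by (intro C_infinity_add C_infinity_partial_deriv C_infinity_cmult f)
  then show "\<exists>f'. C_infinity f' \<and> partial_deriv i h = tf_shift z f'"
    using f by (auto simp: partial_deriv_tf_shift C_infinity_differentiable)
qed (auto simp: differentiable_tf_shift C_infinity_differentiable)

lemma iter_deriv_Cons_tf_shift:
  assumes "C_infinity f"
  shows "iter_deriv (i # is) (tf_shift z f) =
    (\<lambda>y. iter_deriv is (tf_shift z (partial_deriv i f)) y
       + \<i> * complex_of_real (snd z $ i) * iter_deriv is (tf_shift z f) y)"
  using assms
  by (simp add: partial_deriv_tf_shift C_infinity_differentiable tf_shift_add_cmult iter_deriv_add
      iter_deriv_cmult C_infinity_tf_shift C_infinity_cmult C_infinity_partial_deriv)

lemma rapidly_decreasing_partial_deriv: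
  "rapidly_decreasing \<omega> f \<Longrightarrow> rapidly_decreasing \<omega> (partial_deriv i f)"
  unfolding rapidly_decreasing_def by (metis C_infinity_partial_deriv iter_deriv_Cons)

text \<open>The basic estimate, by induction on the number of derivatives. Without derivatives the weight at \<open>x\<close> splits into
  a weight at the translated point, absorbed by the decay of \<open>f\<close> at the larger exponent \<open>\<mu> * L\<close>, and a weight at
  \<open>z\<close>. One further derivative falls either on \<open>f\<close>, which stays rapidly decreasing, or on the modulation, where it
  produces a frequency coordinate, bounded by an exponential of the weight at \<open>z\<close>.\<close>

lemma tf_shift_bound:
  fixes f :: "real^'d \<Rightarrow> complex"
  assumes \<omega>: "weight_function \<omega>" and f: "rapidly_decreasing \<omega> f" and \<mu>: "\<mu> > 0"
  shows "\<exists>C\<ge>0. \<exists>K::nat. \<forall>z x.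
    exp (\<mu> * \<omega> (norm x)) * cmod (iter_deriv is (tf_shift z f) x) \<le> C * exp (real K * \<omega> (norm z))"
  using f
proof (induction "is" arbitrary: f)
  case Nil
  obtain L where L: "L \<ge> 1" "\<And>s t. s \<ge> 0 \<Longrightarrow> t \<ge> 0 \<Longrightarrow> \<omega> (s + t) \<le> L * (\<omega> s + \<omega> t + 1)"
    using weight_triangle[OF \<omega>] by blast
  have "\<mu> * L > 0" using L(1) \<mu> by simp
  then obtain B where B: "\<And>x. exp (\<mu> * L * \<omega> (norm x)) * cmod (f x) \<le> B"
    using Nil unfolding rapidly_decreasing_def by (metis iter_deriv_Nil)
  have "0 \<le> exp (\<mu> * L * \<omega> (norm (0::real^'d))) * cmod (f 0)" by simp
  then have "B \<ge> 0" using B order_trans by blast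
  define K where "K = nat \<lceil>\<mu> * L\<rceil>"
  have K: "\<mu> * L \<le> real K" by (simp add: K_def real_nat_ceiling_ge)
  have "exp (\<mu> * \<omega> (norm x)) * cmod (tf_shift z f x) \<le> exp (\<mu> * L) * B * exp (real K * \<omega> (norm z))" for z x
  proof -
    let ?y = "x - fst z"
    have "\<omega> (norm x) \<le> \<omega> (norm ?y + norm (fst z))"
      using norm_triangle_ineq[of ?y "fst z"] by (intro weight_mono[OF \<omega>]) auto
    also have "\<dots> \<le> L * (\<omega> (norm ?y) + \<omega> (norm (fst z)) + 1)" by (intro L) auto
    also have "\<dots> \<le> L * (\<omega> (norm ?y) + \<omega> (norm z) + 1)"
      using L(1) norm_fst_le[of "fst z" "snd z"]
      by (intro mult_left_mono add_mono weight_mono[OF \<omega>]) auto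
    finally have "\<mu> * \<omega> (norm x) \<le> \<mu> * (L * (\<omega> (norm ?y) + \<omega> (norm z) + 1))"
      using \<mu> by (intro mult_left_mono) auto
    also have "\<dots> = \<mu> * L + \<mu> * L * \<omega> (norm z) + \<mu> * L * \<omega> (norm ?y)"
      by (simp add: algebra_simps)
    also have "\<dots> \<le> \<mu> * L + real K * \<omega> (norm z) + \<mu> * L * \<omega> (norm ?y)"
      by (intro add_right_mono add_left_mono mult_right_mono K weight_nonneg[OF \<omega>]) simp
    finally have "exp (\<mu> * \<omega> (norm x)) \<le> exp (\<mu> * L) * exp (real K * \<omega> (norm z)) * exp (\<mu> * L * \<omega> (norm ?y))"
      by (simp flip: exp_add)
    then have "exp (\<mu> * \<omega> (norm x)) * cmod (f ?y)
        \<le> exp (\<mu> * L) * exp (real K * \<omega> (norm z)) * exp (\<mu> * L * \<omega> (norm ?y)) * cmod (f ?y)"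
      by (rule mult_right_mono) simp
    also have "\<dots> = exp (\<mu> * L) * exp (real K * \<omega> (norm z)) * (exp (\<mu> * L * \<omega> (norm ?y)) * cmod (f ?y))"
      by (simp add: mult_ac)
    also have "\<dots> \<le> exp (\<mu> * L) * exp (real K * \<omega> (norm z)) * B"
      by (intro mult_left_mono B) auto
    finally show ?thesis by (simp add: norm_tf_shift mult_ac)
  qed
  then show ?case using \<open>B \<ge> 0\<close> by (intro exI[of _ "exp (\<mu> * L) * B"] conjI exI[of _ K]) auto
next
  case (Cons i "is")
  obtain C1 K1 where 1: "C1 \<ge> 0" "\<And>z x. exp (\<mu> * \<omega> (norm x)) * cmod (iter_deriv is (tf_shift z (partial_deriv i f)) x)
      \<le> C1 * exp (real K1 * \<omega> (norm z))"
    using Cons.IH[OF rapidly_decreasing_partial_deriv[OF Cons.prems]] by blast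
  obtain C2 K2 where 2: "C2 \<ge> 0" "\<And>z x. exp (\<mu> * \<omega> (norm x)) * cmod (iter_deriv is (tf_shift z f) x)
      \<le> C2 * exp (real K2 * \<omega> (norm z))"
    using Cons.IH[OF Cons.prems] by blast
  obtain C3 K3 where 3: "C3 \<ge> 0" "\<And>t. t \<ge> 0 \<Longrightarrow> 1 + t \<le> C3 * exp (real K3 * \<omega> t)"
    using weight_dominates_powers[OF \<omega>] by blast
  let ?K = "K1 + K2 + K3"
  have "exp (\<mu> * \<omega> (norm x)) * cmod (iter_deriv (i # is) (tf_shift z f) x)
      \<le> (C1 + C3 * C2) * exp (real ?K * \<omega> (norm z))" for z x
  proof -
    have w: "\<omega> (norm z) \<ge> 0" by (simp add: weight_nonneg[OF \<omega>])
    let ?E = "exp (\<mu> * \<omega> (norm x))" and ?e = "\<lambda>k::nat. exp (real k * \<omega> (norm z))"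
    have "\<bar>snd z $ i\<bar> \<le> norm (snd z)" by (rule component_le_norm_cart)
    also have "\<dots> \<le> norm z" using norm_snd_le[of "snd z" "fst z"] by simp
    also have "\<dots> \<le> C3 * ?e K3" using 3(2)[of "norm z"] by simp
    finally have b: "\<bar>snd z $ i\<bar> \<le> C3 * ?e K3" .
    have "cmod (iter_deriv (i # is) (tf_shift z f) x)
        \<le> cmod (iter_deriv is (tf_shift z (partial_deriv i f)) x)
          + \<bar>snd z $ i\<bar> * cmod (iter_deriv is (tf_shift z f) x)"
      using Cons.prems norm_triangle_ineq[of "iter_deriv is (tf_shift z (partial_deriv i f)) x"
          "\<i> * complex_of_real (snd z $ i) * iter_deriv is (tf_shift z f) x"]
      by (simp only: iter_deriv_Cons_tf_shift rapidly_decreasing_def) (simp add: norm_mult)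
    then have "?E * cmod (iter_deriv (i # is) (tf_shift z f) x)
        \<le> ?E * (cmod (iter_deriv is (tf_shift z (partial_deriv i f)) x)
          + \<bar>snd z $ i\<bar> * cmod (iter_deriv is (tf_shift z f) x))"
      by (rule mult_left_mono) simp
    also have "\<dots> = ?E * cmod (iter_deriv is (tf_shift z (partial_deriv i f)) x)
          + \<bar>snd z $ i\<bar> * (?E * cmod (iter_deriv is (tf_shift z f) x))"
      by (simp add: algebra_simps)
    also have "\<dots> \<le> C1 * ?e K1 + (C3 * ?e K3) * (C2 * ?e K2)"
      by (intro add_mono 1(2) mult_mono[OF b 2(2)] mult_nonneg_nonneg 3(1)) simp_all
    also have "\<dots> = C1 * ?e K1 + C3 * C2 * ?e (K2 + K3)"
      by (simp add: exp_add algebra_simps)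
    also have "\<dots> \<le> C1 * ?e ?K + C3 * C2 * ?e ?K"
      using w 1(1) 2(1) 3(1) by (intro add_mono mult_left_mono) (auto intro!: mult_right_mono)
    finally show ?thesis by (simp add: distrib_right)
  qed
  then show ?case using 1(1) 2(1) 3(1) by (intro exI[of _ "C1 + C3 * C2"] conjI exI[of _ ?K]) auto
qed

section \<open>Summation over the lattice\<close>

lemma summable_on_int_inverse_square:
  assumes "a > 0"
  shows "(\<lambda>k::int. 1 / (1 + a * \<bar>real_of_int k\<bar>)\<^sup>2) summable_on UNIV"
proof -
  let ?q = "\<lambda>k::int. 1 / (1 + a * \<bar>real_of_int k\<bar>)\<^sup>2"
  \<comment> \<open>With this \<open>m\<close> one has \<open>m * (n + 1) \<le> 1 + a * n\<close>, which compares with the series of inverse squares.\<close>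
  define m where "m = min 1 a"
  have m: "m > 0" "m \<le> 1" "m \<le> a" using assms by (auto simp: m_def)
  have half: "(\<lambda>n::nat. 1 / (1 + a * real n)\<^sup>2) summable_on UNIV"
  proof (rule summable_on_comparison_test)
    show "(\<lambda>n::nat. 1 / m\<^sup>2 * (1 / (real n + 1)\<^sup>2)) summable_on UNIV"
      using inverse_squares_sums
      by (intro summable_on_cmult_right) (simp add: summable_on_UNIV_nonneg_real_iff sums_iff add.commute)
    show "1 / (1 + a * real n)\<^sup>2 \<le> 1 / m\<^sup>2 * (1 / (real n + 1)\<^sup>2)" for n
    proof -
      have "m * (real n + 1) \<le> 1 + a * real n"
        using m mult_right_mono[OF m(3), of "real n"] by (simp add: algebra_simps)
      moreover have pos: "0 < m * (real n + 1)" using m by (intro mult_pos_pos) auto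
      ultimately have "(m * (real n + 1))\<^sup>2 \<le> (1 + a * real n)\<^sup>2"
        by (rule power_mono[OF _ less_imp_le])
      moreover have "0 < 1 + a * real n" using assms by (intro add_pos_nonneg) auto
      ultimately have "1 / (1 + a * real n)\<^sup>2 \<le> 1 / (m * (real n + 1))\<^sup>2"
        by (intro divide_left_mono mult_pos_pos zero_less_power pos zero_le_one)
      then show ?thesis by (simp add: power_mult_distrib)
    qed
  qed auto
  have 1: "?q summable_on range int"
    by (subst summable_on_reindex) (use half in \<open>auto simp: o_def\<close>)
  have 2: "?q summable_on range (\<lambda>n. - int n)"
    by (subst summable_on_reindex) (use half in \<open>auto simp: o_def inj_on_def\<close>)
  have "?q summable_on (range (\<lambda>n. - int n) - range int)"
    by (rule summable_on_subset_banach[OF 2]) auto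
  with 1 have "?q summable_on (range int \<union> (range (\<lambda>n. - int n) - range int))"
    by (rule summable_on_Un_disjoint) auto
  moreover have "range int \<union> (range (\<lambda>n. - int n) - range int) = UNIV"
    by (auto, metis int_cases2 rangeI)
  ultimately show ?thesis by simp
qed

text \<open>A finite set of vectors lies in a finite box, over which the sum of products factors into a product of sums.\<close>

lemma summable_on_vec_prod:
  fixes q :: "'a \<Rightarrow> real"
  assumes q: "q summable_on UNIV" and nonneg: "\<And>k. q k \<ge> 0"
  shows "(\<lambda>k::'a^'d::finite. \<Prod>i\<in>UNIV. q (k $ i)) summable_on UNIV"
proof (rule nonneg_bounded_partial_sums_imp_summable_on)
  let ?S = "infsum q UNIV"
  show "\<forall>\<^sub>F F in finite_subsets_at_top UNIV.
      (\<Sum>k\<in>F. \<Prod>i\<in>UNIV. q ((k::'a^'d) $ i)) \<le> ?S ^ CARD('d)"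
    unfolding eventually_finite_subsets_at_top
  proof (intro exI[of _ "{}"] conjI allI impI)
    fix F :: "('a^'d) set" assume "finite F \<and> {} \<subseteq> F \<and> F \<subseteq> UNIV"
    then have F: "finite F" by simp
    define Z where "Z = (\<Union>k\<in>F. range (($) k))"
    have Z: "finite Z" using F by (simp add: Z_def)
    have "(\<Sum>k\<in>F. \<Prod>i\<in>UNIV. q (k $ i)) = (\<Sum>g\<in>($) ` F. \<Prod>i\<in>UNIV. q (g i))"
      by (subst sum.reindex) (auto simp: inj_on_def vec_eq_iff fun_eq_iff)
    also have "\<dots> \<le> (\<Sum>g\<in>PiE UNIV (\<lambda>_::'d. Z). \<Prod>i\<in>UNIV. q (g i))"
      by (rule sum_mono2) (auto simp: Z_def intro!: finite_PiE F prod_nonneg nonneg)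
    also have "\<dots> = (\<Prod>i::'d\<in>UNIV. \<Sum>z\<in>Z. q z)"
      by (rule prod_sum_PiE[symmetric]) (simp_all add: Z)
    also have "\<dots> \<le> (\<Prod>i::'d\<in>UNIV. ?S)"
      by (intro prod_mono conjI sum_nonneg nonneg finite_sum_le_infsum q Z) (auto simp: nonneg)
    finally show "(\<Sum>k\<in>F. \<Prod>i\<in>UNIV. q (k $ i)) \<le> ?S ^ CARD('d)" by simp
  qed auto
qed (simp add: prod_nonneg nonneg)

text \<open>Every coordinate of a lattice point \<open>\<sigma>\<close> is at most \<open>|\<sigma>|\<close>. A suitable exponential of \<open>\<omega>(|\<sigma>|)\<close> dominates
  \<open>(1 + |\<sigma>|)\<^sup>4\<^sup>d\<close>, that is, a square for each of the \<open>2d\<close> coordinates, and the product of the inverse squares is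
  summable.\<close>

lemma summable_on_lattice_weight:
  fixes \<alpha>\<^sub>0 \<beta>\<^sub>0 :: real
  assumes \<omega>: "weight_function \<omega>" and "\<alpha>\<^sub>0 > 0" "\<beta>\<^sub>0 > 0"
  obtains N :: nat where
    "(\<lambda>kn::(int^'d) \<times> (int^'d). exp (- real N * \<omega> (norm (lattice_point \<alpha>\<^sub>0 \<beta>\<^sub>0 kn)))) summable_on UNIV"
proof -
  obtain C and K :: nat where C: "C \<ge> 0" "\<And>t. t \<ge> 0 \<Longrightarrow> 1 + t \<le> C * exp (real K * \<omega> t)"
    using weight_dominates_powers[OF \<omega>] by blast
  define q where "q a k = 1 / (1 + a * \<bar>real_of_int k\<bar>)\<^sup>2" for a k
  define p where "p a k = (\<Prod>i\<in>UNIV. q a (k $ i))" for a and k :: "int^'d"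
  define D where "D = CARD('d)"
  have q_nonneg: "q a k \<ge> 0" for a k by (simp add: q_def)
  have p_nonneg: "p a k \<ge> 0" for a k by (simp add: p_def prod_nonneg q_nonneg)
  have p: "p a summable_on UNIV" if "a > 0" for a
    unfolding p_def q_def
    by (intro summable_on_vec_prod summable_on_int_inverse_square that) simp
  have component: "(1 + t) ^ (2 * D) * p a k \<ge> 1"
    if "\<And>i. a * \<bar>real_of_int (k $ i)\<bar> \<le> t" "a > 0" for a t and k :: "int^'d"
  proof -
    have "t \<ge> 0" using that by (meson abs_ge_zero mult_nonneg_nonneg less_imp_le order_trans)
    have "1 \<le> (\<Prod>i::'d\<in>UNIV. (1 + t)\<^sup>2 * q a (k $ i))"
    proof (rule prod_ge_1)
      fix i
      have "(1 + a * \<bar>real_of_int (k $ i)\<bar>)\<^sup>2 \<le> (1 + t)\<^sup>2"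
        using that by (intro power_mono) auto
      moreover have "(1 + a * \<bar>real_of_int (k $ i)\<bar>)\<^sup>2 > 0"
        using that(2) by (intro zero_less_power add_pos_nonneg) auto
      ultimately show "1 \<le> (1 + t)\<^sup>2 * q a (k $ i)" by (simp add: q_def)
    qed
    also have "\<dots> = (1 + t) ^ (2 * D) * p a k"
      by (simp add: prod.distrib p_def D_def power_mult)
    finally show ?thesis .
  qed
  define N where "N = K * (4 * D)"
  have "(\<lambda>kn::(int^'d) \<times> (int^'d). exp (- real N * \<omega> (norm (lattice_point \<alpha>\<^sub>0 \<beta>\<^sub>0 kn)))) summable_on UNIV"
  proof (rule summable_on_comparison_test)
    have "(\<lambda>kn. p \<alpha>\<^sub>0 (fst kn) * p \<beta>\<^sub>0 (snd kn)) summable_on (UNIV \<times> UNIV)"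
    proof (rule summable_on_SigmaI)
      show "((\<lambda>n. p \<alpha>\<^sub>0 (fst (k, n)) * p \<beta>\<^sub>0 (snd (k, n))) has_sum (p \<alpha>\<^sub>0 k * infsum (p \<beta>\<^sub>0) UNIV)) UNIV" for k
        using has_sum_cmult_right[OF has_sum_infsum[OF p[OF assms(3)]], of "p \<alpha>\<^sub>0 k"] by simp
      show "(\<lambda>k. p \<alpha>\<^sub>0 k * infsum (p \<beta>\<^sub>0) UNIV) summable_on UNIV"
        by (intro summable_on_cmult_left p assms)
    qed (simp add: p_nonneg)
    then show "(\<lambda>kn. C ^ (4 * D) * (p \<alpha>\<^sub>0 (fst kn) * p \<beta>\<^sub>0 (snd kn))) summable_on UNIV"
      by (intro summable_on_cmult_right) simp
    fix kn :: "(int^'d) \<times> (int^'d)"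
    obtain k n where kn: "kn = (k, n)" by (cases kn)
    let ?\<sigma> = "lattice_point \<alpha>\<^sub>0 \<beta>\<^sub>0 kn"
    define t where "t = norm ?\<sigma>"
    have t: "t \<ge> 0" by (simp add: t_def)
    have "\<alpha>\<^sub>0 * \<bar>real_of_int (k $ i)\<bar> \<le> t" for i
    proof -
      have "\<bar>fst ?\<sigma> $ i\<bar> \<le> norm (fst ?\<sigma>)" by (rule component_le_norm_cart)
      also have "\<dots> \<le> t" using norm_fst_le[of "fst ?\<sigma>" "snd ?\<sigma>"] by (simp add: t_def)
      finally show ?thesis using assms by (simp add: lattice_point_def kn abs_mult)
    qed
    then have a: "(1 + t) ^ (2 * D) * p \<alpha>\<^sub>0 k \<ge> 1" by (rule component) (rule assms)
    have "\<beta>\<^sub>0 * \<bar>real_of_int (n $ i)\<bar> \<le> t" for i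
    proof -
      have "\<bar>snd ?\<sigma> $ i\<bar> \<le> norm (snd ?\<sigma>)" by (rule component_le_norm_cart)
      also have "\<dots> \<le> t" using norm_snd_le[of "snd ?\<sigma>" "fst ?\<sigma>"] by (simp add: t_def)
      finally show ?thesis using assms by (simp add: lattice_point_def kn abs_mult)
    qed
    then have b: "(1 + t) ^ (2 * D) * p \<beta>\<^sub>0 n \<ge> 1" by (rule component) (rule assms)
    have "1 \<le> ((1 + t) ^ (2 * D) * p \<alpha>\<^sub>0 k) * ((1 + t) ^ (2 * D) * p \<beta>\<^sub>0 n)"
      using mult_mono[OF a b] a by simp
    also have "\<dots> = (1 + t) ^ (4 * D) * (p \<alpha>\<^sub>0 k * p \<beta>\<^sub>0 n)"
      by (simp add: mult_ac flip: power_add)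
    also have "\<dots> \<le> (C * exp (real K * \<omega> t)) ^ (4 * D) * (p \<alpha>\<^sub>0 k * p \<beta>\<^sub>0 n)"
      using C(2)[OF t] t by (intro mult_right_mono power_mono mult_nonneg_nonneg p_nonneg) auto
    also have "\<dots> = exp (real N * \<omega> t) * (C ^ (4 * D) * (p \<alpha>\<^sub>0 k * p \<beta>\<^sub>0 n))"
      by (simp add: N_def power_mult_distrib mult_ac flip: exp_of_nat_mult)
    finally have "exp (- real N * \<omega> t) * 1
        \<le> exp (- real N * \<omega> t) * (exp (real N * \<omega> t) * (C ^ (4 * D) * (p \<alpha>\<^sub>0 k * p \<beta>\<^sub>0 n)))"
      by (intro mult_left_mono) auto
    then show "exp (- real N * \<omega> (norm ?\<sigma>)) \<le> C ^ (4 * D) * (p \<alpha>\<^sub>0 (fst kn) * p \<beta>\<^sub>0 (snd kn))"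
      by (simp add: kn t_def mult.assoc[symmetric] flip: exp_add)
  qed simp
  then show ?thesis by (rule that)
qed

section \<open>Fourier transforms\<close>

lemma integrable_modulated:
  fixes u :: "real^'d \<Rightarrow> complex"
  assumes "integrable lborel u"
  shows "integrable lborel (\<lambda>x. u x * exp (- \<i> * complex_of_real (x \<bullet> \<xi>)))"
proof (rule Bochner_Integration.integrable_bound[OF assms])
  have [measurable]: "u \<in> borel_measurable borel" using assms by (auto dest: borel_measurable_integrable)
  show "(\<lambda>x. u x * exp (- \<i> * complex_of_real (x \<bullet> \<xi>))) \<in> borel_measurable lborel"
    by (intro borel_measurable_times borel_measurable_continuous_onI) (auto intro!: continuous_intros)
qed (simp add: norm_mult)

lemma fourier_diff:
  assumes "integrable lborel u" "integrable lborel v"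
  shows "fourier (\<lambda>x. u x - v x) = (\<lambda>\<xi>. fourier u \<xi> - fourier v \<xi>)"
  using integrable_modulated[OF assms(1)] integrable_modulated[OF assms(2)]
  by (auto simp: fourier_def fun_eq_iff left_diff_distrib)

lemma fourier_sum:
  assumes "\<And>j. j \<in> F \<Longrightarrow> integrable lborel (u j)"
  shows "fourier (\<lambda>x. \<Sum>j\<in>F. u j x) = (\<lambda>\<xi>. \<Sum>j\<in>F. fourier (u j) \<xi>)"
  unfolding fourier_def sum_distrib_right
  by (intro ext Bochner_Integration.integral_sum integrable_modulated assms)

lemma fourier_cmult: "fourier (\<lambda>x. c * u x) = (\<lambda>\<xi>. c * fourier u \<xi>)"
  by (simp add: fourier_def fun_eq_iff mult.assoc)

lemma
  fixes g :: "real^'d \<Rightarrow> 'b::{banach,second_countable_topology}"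
  shows integrable_lborel_translate: "integrable lborel g \<Longrightarrow> integrable lborel (\<lambda>x. g (a + x))"
    and integral_lborel_translate:
      "g \<in> borel_measurable borel \<Longrightarrow> (LINT x|lborel. g (a + x)) = (LINT x|lborel. g x)"
proof -
  have m: "(+) a \<in> lborel \<rightarrow>\<^sub>M borel" by measurable
  show "integrable lborel (\<lambda>x. g (a + x))" if g: "integrable lborel g"
  proof (rule integrable_distr[OF m])
    show "integrable (distr lborel borel ((+) a)) g"
      unfolding lborel_distr_plus by (rule g)
  qed
  show "(LINT x|lborel. g (a + x)) = (LINT x|lborel. g x)" if g: "g \<in> borel_measurable borel"
    using integral_distr[OF m g] unfolding lborel_distr_plus by simp
qed

lemma integrable_tf_shift:
  fixes u :: "real^'d \<Rightarrow> complex"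
  assumes "integrable lborel u"
  shows "integrable lborel (tf_shift z u)"
proof -
  have "integrable lborel (\<lambda>y. u (- fst z + y))"
    by (rule integrable_lborel_translate[OF assms])
  from integrable_modulated[OF this, of "- snd z"] show ?thesis
    by (simp add: tf_shift_def[abs_def] mult.commute)
qed

text \<open>The Fourier transform turns translation into modulation and modulation into translation; the phase
  comes from the order in which \<open>tf_shift\<close> applies the two.\<close>

lemma fourier_tf_shift:
  fixes u :: "real^'d \<Rightarrow> complex"
  assumes "integrable lborel u"
  shows "fourier (tf_shift (a, b) u) \<xi> = exp (\<i> * complex_of_real (a \<bullet> b)) * tf_shift (b, - a) (fourier u) \<xi>"
proof -
  let ?g = "\<lambda>y. tf_shift (a, b) u y * exp (- \<i> * complex_of_real (y \<bullet> \<xi>))"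
  have "?g \<in> borel_measurable borel"
    using borel_measurable_integrable[OF integrable_modulated[OF integrable_tf_shift[OF assms]]] by simp
  then have "fourier (tf_shift (a, b) u) \<xi> = (LINT x|lborel. ?g (a + x))"
    unfolding fourier_def by (rule integral_lborel_translate[symmetric])
  also have "\<dots> = (LINT x|lborel. exp (\<i> * complex_of_real (a \<bullet> (b - \<xi>))) *
      (u x * exp (- \<i> * complex_of_real (x \<bullet> (\<xi> - b)))))"
    by (rule arg_cong[where f = "integral\<^sup>L lborel"])
       (simp add: tf_shift_def fun_eq_iff inner_add_left inner_diff_right mult_ac flip: exp_add,
        simp add: algebra_simps)
  also have "\<dots> = exp (\<i> * complex_of_real (a \<bullet> (b - \<xi>))) * fourier u (\<xi> - b)"
    by (simp add: fourier_def)
  also have "exp (\<i> * complex_of_real (a \<bullet> (b - \<xi>)))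
      = exp (\<i> * complex_of_real (a \<bullet> b)) * exp (\<i> * complex_of_real (\<xi> \<bullet> (- a)))"
    by (simp add: inner_diff_right inner_commute[of \<xi>] algebra_simps flip: exp_add)
  finally show ?thesis by (simp add: tf_shift_def[of "(b, - a)"] mult.assoc)
qed

lemma
  fixes f :: "'j::countable \<Rightarrow> 'a \<Rightarrow> 'b::{banach,second_countable_topology}"
  assumes int: "\<And>j. integrable M (f j)"
    and pointwise: "\<And>x. (\<lambda>j. norm (f j x)) summable_on UNIV"
    and norms: "(\<lambda>j. LINT x|M. norm (f j x)) summable_on UNIV"
  shows integrable_infsum: "integrable M (\<lambda>x. \<Sum>\<^sub>\<infinity>j. f j x)"
    and integral_infsum: "(LINT x|M. (\<Sum>\<^sub>\<infinity>j. f j x)) = (\<Sum>\<^sub>\<infinity>j. LINT x|M. f j x)"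
proof -
  let ?R = "range (to_nat :: 'j \<Rightarrow> nat)"
  define F where "F n x = (if n \<in> ?R then f (from_nat n) x else 0)" for n x
  have F_in: "F n = f (from_nat n)" if "n \<in> ?R" for n using that by (simp add: F_def fun_eq_iff)
  have F_out: "F n = (\<lambda>x. 0)" if "n \<notin> ?R" for n using that by (simp add: F_def fun_eq_iff)
  have F_int: "integrable M (F n)" for n by (cases "n \<in> ?R") (simp_all add: F_in F_out int)
  have "(\<lambda>n. if n \<in> ?R then norm (f (from_nat n) x) else 0) sums (\<Sum>\<^sub>\<infinity>j. norm (f j x))" for x
    by (rule sums_to_nat) (rule has_sum_infsum[OF pointwise])
  moreover have "(if n \<in> ?R then norm (f (from_nat n) x) else 0) = norm (F n x)" for n x
    by (simp add: F_def)
  ultimately have F_norm: "summable (\<lambda>n. norm (F n x))" for x by (simp add: sums_iff)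
  have "(\<lambda>n. if n \<in> ?R then LINT x|M. norm (f (from_nat n) x) else 0) sums (\<Sum>\<^sub>\<infinity>j. LINT x|M. norm (f j x))"
    by (rule sums_to_nat) (rule has_sum_infsum[OF norms])
  moreover have "(if n \<in> ?R then LINT x|M. norm (f (from_nat n) x) else 0) = (LINT x|M. norm (F n x))" for n
    by (cases "n \<in> ?R") (simp_all add: F_in F_out)
  ultimately have F_norms: "summable (\<lambda>n. LINT x|M. norm (F n x))" by (simp add: sums_iff)
  have "(\<lambda>n. F n x) sums (\<Sum>\<^sub>\<infinity>j. f j x)" for x
    unfolding F_def by (rule sums_to_nat) (rule has_sum_infsum[OF abs_summable_summable[OF pointwise]])
  then have F_suminf: "(\<Sum>n. F n x) = (\<Sum>\<^sub>\<infinity>j. f j x)" for x by (simp add: sums_iff)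
  show "integrable M (\<lambda>x. \<Sum>\<^sub>\<infinity>j. f j x)"
    using integrable_suminf[OF F_int AE_I2[OF F_norm] F_norms] by (simp add: F_suminf)
  have "(\<lambda>n. LINT x|M. F n x) sums (LINT x|M. (\<Sum>\<^sub>\<infinity>j. f j x))"
    using sums_integral[OF F_int AE_I2[OF F_norm] F_norms] by (simp add: F_suminf)
  moreover have "(LINT x|M. F n x) = (if n \<in> ?R then LINT x|M. f (from_nat n) x else 0)" for n
    by (cases "n \<in> ?R") (simp_all add: F_in F_out)
  moreover have "(\<lambda>n. if n \<in> ?R then LINT x|M. f (from_nat n) x else 0) sums (\<Sum>\<^sub>\<infinity>j. LINT x|M. f j x)"
    by (rule sums_to_nat, rule has_sum_infsum, rule dominated_summable_on[OF norms])
       (rule integral_norm_bound)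
  ultimately show "(LINT x|M. (\<Sum>\<^sub>\<infinity>j. f j x)) = (\<Sum>\<^sub>\<infinity>j. LINT x|M. f j x)"
    by (simp add: sums_iff)
qed

section \<open>Synthesis of a rapidly decreasing function along a family of time-frequency shifts\<close>

text \<open>The coefficients and the points are families over an arbitrary index type. This lets the same results serve the
  lattice and, on the Fourier side, its image under \<open>(x, \<xi>) \<mapsto> (\<xi>, -x)\<close>.\<close>

definition rapid_coeffs :: "(real \<Rightarrow> real) \<Rightarrow> ('j \<Rightarrow> (real^'d::finite) \<times> (real^'d)) \<Rightarrow> ('j \<Rightarrow> complex) \<Rightarrow> bool" where
  "rapid_coeffs \<omega> z a \<longleftrightarrow> (\<forall>k::nat. \<exists>M. \<forall>j. cmod (a j) * exp (real k * \<omega> (norm (z j))) \<le> M)"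

definition synth :: "('j \<Rightarrow> (real^'d::finite) \<times> (real^'d)) \<Rightarrow> (real^'d \<Rightarrow> complex) \<Rightarrow> ('j \<Rightarrow> complex)
    \<Rightarrow> real^'d \<Rightarrow> complex" where
  "synth z f a x = (\<Sum>\<^sub>\<infinity>j. a j * tf_shift (z j) f x)"

lemma C_infinity_cmult_tf_shift: "C_infinity f \<Longrightarrow> C_infinity (\<lambda>x. a * tf_shift w f x)"
  by (intro C_infinity_cmult C_infinity_tf_shift)

text \<open>The constants of \<open>tf_shift_bound\<close>, chosen as functions of the exponent and the list of derivatives and hence
  once and for all points and coefficients.\<close>

lemma tf_shift_bound_constants:
  fixes f :: "real^'d::finite \<Rightarrow> complex"
  assumes \<omega>: "weight_function \<omega>" and f: "rapidly_decreasing \<omega> f"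
  obtains C :: "real \<Rightarrow> 'd list \<Rightarrow> real" and K :: "real \<Rightarrow> 'd list \<Rightarrow> nat"
  where "\<And>\<mu> is. C \<mu> is \<ge> 0"
    and "\<And>\<mu> is w a x. \<mu> > 0 \<Longrightarrow> exp (\<mu> * \<omega> (norm x)) * cmod (iter_deriv is (\<lambda>x. a * tf_shift w f x) x)
          \<le> C \<mu> is * (cmod a * exp (real (K \<mu> is) * \<omega> (norm w)))"
proof -
  have smooth: "C_infinity f" using f by (simp add: rapidly_decreasing_def)
  have "\<exists>C K. C \<ge> 0 \<and> (\<mu> > 0 \<longrightarrow> (\<forall>w x. exp (\<mu> * \<omega> (norm x)) * cmod (iter_deriv is (tf_shift w f) x)
      \<le> C * exp (real (K::nat) * \<omega> (norm w))))" for \<mu> "is"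
  proof (cases "\<mu> > 0")
    case True
    with tf_shift_bound[OF \<omega> f] show ?thesis by blast
  qed auto
  then obtain C K where CK: "\<And>\<mu> is. C \<mu> is \<ge> 0"
      "\<And>\<mu> is w x. \<mu> > 0 \<Longrightarrow> exp (\<mu> * \<omega> (norm x)) * cmod (iter_deriv is (tf_shift w f) x)
        \<le> C \<mu> is * exp (real (K \<mu> is :: nat) * \<omega> (norm w))"
    by metis
  have "exp (\<mu> * \<omega> (norm x)) * cmod (iter_deriv is (\<lambda>x. a * tf_shift w f x) x)
          \<le> C \<mu> is * (cmod a * exp (real (K \<mu> is) * \<omega> (norm w)))" if "\<mu> > 0" for \<mu> "is" w a x
    using mult_left_mono[OF CK(2)[OF that, of x "is" w], of "cmod a"]
    by (simp add: iter_deriv_cmult C_infinity_tf_shift smooth norm_mult mult_ac)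
  with CK(1) show ?thesis by (rule that)
qed

context
  fixes \<omega> :: "real \<Rightarrow> real" and N :: nat
    and z :: "'j::countable \<Rightarrow> (real^'d::finite) \<times> (real^'d)"
  assumes \<omega>: "weight_function \<omega>"
    and summable_z: "(\<lambda>j. exp (- real N * \<omega> (norm (z j)))) summable_on UNIV"
begin

text \<open>Spending \<open>N\<close> of the available exponent on the coefficient buys a summable factor.\<close>

lemma coeff_decay:
  assumes "cmod a * exp (real (K + N) * \<omega> r) \<le> M"
  shows "cmod a * exp (real K * \<omega> r) \<le> M * exp (- real N * \<omega> r)"
proof -
  have "cmod a * exp (real K * \<omega> r) = cmod a * exp (real (K + N) * \<omega> r) * exp (- real N * \<omega> r)"
    by (simp add: algebra_simps flip: exp_add)
  also have "\<dots> \<le> M * exp (- real N * \<omega> r)"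
    by (rule mult_right_mono[OF assms]) simp
  finally show ?thesis .
qed

lemma
  assumes "\<And>j. cmod (a j) * exp (real (K + N) * \<omega> (norm (z j))) \<le> M"
  shows summable_coeffs: "(\<lambda>j. cmod (a j) * exp (real K * \<omega> (norm (z j)))) summable_on UNIV"
    and infsum_coeffs_le: "(\<Sum>\<^sub>\<infinity>j. cmod (a j) * exp (real K * \<omega> (norm (z j))))
      \<le> M * (\<Sum>\<^sub>\<infinity>j. exp (- real N * \<omega> (norm (z j))))"
proof -
  have *: "(\<lambda>j. M * exp (- real N * \<omega> (norm (z j)))) summable_on UNIV"
    by (rule summable_on_cmult_right[OF summable_z])
  show summ: "(\<lambda>j. cmod (a j) * exp (real K * \<omega> (norm (z j)))) summable_on UNIV"
    by (rule summable_on_comparison_test[OF * coeff_decay[OF assms]]) simp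
  show "(\<Sum>\<^sub>\<infinity>j. cmod (a j) * exp (real K * \<omega> (norm (z j))))
      \<le> M * (\<Sum>\<^sub>\<infinity>j. exp (- real N * \<omega> (norm (z j))))"
    unfolding infsum_cmult_right'[symmetric]
    by (rule infsum_mono[OF summ * coeff_decay[OF assms]])
qed

lemma rapid_coeffs_summable:
  assumes "rapid_coeffs \<omega> z a"
  shows "(\<lambda>j. cmod (a j) * exp (real K * \<omega> (norm (z j)))) summable_on UNIV"
  using assms summable_coeffs unfolding rapid_coeffs_def by blast

context
  fixes f :: "real^'d \<Rightarrow> complex"
  assumes f: "rapidly_decreasing \<omega> f"
begin

text \<open>The three facts are obtained together, from the dominating series \<open>B\<close> of the terms. In the last one the constants
  \<open>C\<close> and \<open>K\<close> precede the coefficients, which is what continuity of the operator requires.\<close>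

lemma rapidly_decreasing_synth: "rapid_coeffs \<omega> z a \<Longrightarrow> rapidly_decreasing \<omega> (synth z f a)"
  and synth_tail: "rapid_coeffs \<omega> z a \<Longrightarrow> \<mu> > 0 \<Longrightarrow> \<exists>B. B summable_on UNIV \<and> (\<forall>F x. finite F \<longrightarrow>
      exp (\<mu> * \<omega> (norm x)) * cmod (iter_deriv is (\<lambda>x. synth z f a x - (\<Sum>j\<in>F. a j * tf_shift (z j) f x)) x)
        \<le> infsum B (- F))"
  and synth_estimate: "\<mu> > 0 \<Longrightarrow> \<exists>C\<ge>0. \<exists>K::nat. \<forall>a M. rapid_coeffs \<omega> z a \<longrightarrow>
      (\<forall>j. cmod (a j) * exp (real K * \<omega> (norm (z j))) \<le> M) \<longrightarrow>
      (\<forall>x. exp (\<mu> * \<omega> (norm x)) * cmod (iter_deriv is (synth z f a) x) \<le> C * M)"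
proof -
  obtain C K where CK: "\<And>\<mu> is. C \<mu> is \<ge> 0"
    "\<And>\<mu> is w a x. \<mu> > 0 \<Longrightarrow> exp (\<mu> * \<omega> (norm x)) * cmod (iter_deriv is (\<lambda>x. a * tf_shift w f x) x)
          \<le> C \<mu> is * (cmod a * exp (real (K \<mu> is :: nat) * \<omega> (norm w)))"
    by (rule tf_shift_bound_constants[OF \<omega> f]) blast
  define B where "B a \<mu> is j = C \<mu> is * (cmod (a j) * exp (real (K \<mu> is) * \<omega> (norm (z j))))" for a \<mu> "is" j
  have summ: "B a \<mu> is summable_on UNIV" if "rapid_coeffs \<omega> z a" for a \<mu> "is"
    unfolding B_def by (intro summable_on_cmult_right rapid_coeffs_summable that)
  have bound: "exp (\<mu> * \<omega> (norm x)) * cmod (iter_deriv is (\<lambda>x. a j * tf_shift (z j) f x) x) \<le> B a \<mu> is j"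
    if "\<mu> > 0" for a \<mu> "is" j x
    unfolding B_def by (rule CK(2)[OF that])
  have smooth: "C_infinity f" using f by (simp add: rapidly_decreasing_def)
  let ?S = "\<Sum>\<^sub>\<infinity>j. exp (- real N * \<omega> (norm (z j)))"
  note series = weight_nonneg[OF \<omega>] C_infinity_cmult_tf_shift[OF smooth] summ bound
  show "rapidly_decreasing \<omega> (synth z f a)" if "rapid_coeffs \<omega> z a" for a
    unfolding synth_def[abs_def] by (rule rapidly_decreasing_infsum[OF series]) (use that in auto)
  have tail: "exp (\<mu> * \<omega> (norm x)) * cmod (iter_deriv is (\<lambda>x. synth z f a x - (\<Sum>j\<in>F. a j * tf_shift (z j) f x)) x)
        \<le> infsum (B a \<mu> is) (- F)" if "rapid_coeffs \<omega> z a" "\<mu> > 0" "finite F" for a \<mu> "is" F x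
    unfolding synth_def by (rule weighted_tail_bound[OF series]) (use that in auto)
  show "\<exists>B. B summable_on UNIV \<and> (\<forall>F x. finite F \<longrightarrow>
      exp (\<mu> * \<omega> (norm x)) * cmod (iter_deriv is (\<lambda>x. synth z f a x - (\<Sum>j\<in>F. a j * tf_shift (z j) f x)) x)
        \<le> infsum B (- F))" if "rapid_coeffs \<omega> z a" "\<mu> > 0" for a \<mu> "is"
    using summ[OF that(1)] tail[OF that] by blast
  show "\<exists>C\<ge>0. \<exists>K::nat. \<forall>a M. rapid_coeffs \<omega> z a \<longrightarrow>
      (\<forall>j. cmod (a j) * exp (real K * \<omega> (norm (z j))) \<le> M) \<longrightarrow>
      (\<forall>x. exp (\<mu> * \<omega> (norm x)) * cmod (iter_deriv is (synth z f a) x) \<le> C * M)" if "\<mu> > 0" for \<mu> "is"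
  proof (intro exI[of _ "C \<mu> is * ?S"] conjI exI[of _ "K \<mu> is + N"] allI impI)
    fix a M x
    assume a: "rapid_coeffs \<omega> z a" and M: "\<forall>j. cmod (a j) * exp (real (K \<mu> is + N) * \<omega> (norm (z j))) \<le> M"
    have "exp (\<mu> * \<omega> (norm x)) * cmod (iter_deriv is (synth z f a) x) \<le> infsum (B a \<mu> is) UNIV"
      using tail[OF a that finite.emptyI] by simp
    also have "\<dots> = C \<mu> is * (\<Sum>\<^sub>\<infinity>j. cmod (a j) * exp (real (K \<mu> is) * \<omega> (norm (z j))))"
      unfolding B_def by (rule infsum_cmult_right')
    also have "\<dots> \<le> C \<mu> is * (M * ?S)"
      using M by (intro mult_left_mono infsum_coeffs_le CK(1)) blast
    finally show "exp (\<mu> * \<omega> (norm x)) * cmod (iter_deriv is (synth z f a) x) \<le> C \<mu> is * ?S * M"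
      by (simp add: mult_ac)
  qed (simp add: CK(1) infsum_nonneg)
qed

lemma synth_abs_summable:
  assumes "rapid_coeffs \<omega> z a"
  shows "(\<lambda>j. cmod (a j * tf_shift (z j) f x)) summable_on UNIV"
proof -
  obtain B where B: "\<And>x. exp (1 * \<omega> (norm x)) * cmod (f x) \<le> B"
    using f unfolding rapidly_decreasing_def by (metis iter_deriv_Nil zero_less_one)
  have fB: "cmod (f x) \<le> B" for x
  proof -
    have "1 * cmod (f x) \<le> exp (1 * \<omega> (norm x)) * cmod (f x)"
      using weight_nonneg[OF \<omega>, of "norm x"] by (intro mult_right_mono) auto
    with B[of x] show ?thesis by simp
  qed
  have "(\<lambda>j. cmod (a j)) summable_on UNIV"
    using rapid_coeffs_summable[OF assms, of 0] by simp
  then have "(\<lambda>j. cmod (a j) * B) summable_on UNIV" by (rule summable_on_cmult_left)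
  then show ?thesis
    by (rule summable_on_comparison_test) (auto simp: norm_mult norm_tf_shift fB intro!: mult_left_mono)
qed

lemma synth_diff:
  assumes "rapid_coeffs \<omega> z a" "rapid_coeffs \<omega> z b"
  shows "synth z f (\<lambda>j. a j - b j) = (\<lambda>x. synth z f a x - synth z f b x)"
  unfolding synth_def fun_eq_iff left_diff_distrib
proof
  fix x
  have sums: "((\<lambda>j. a j * tf_shift (z j) f x) has_sum synth z f a x) UNIV" if "rapid_coeffs \<omega> z a" for a
    unfolding synth_def by (rule has_sum_infsum, rule abs_summable_summable, rule synth_abs_summable[OF that])
  have "((\<lambda>j. - (b j * tf_shift (z j) f x)) has_sum - synth z f b x) UNIV"
    using sums[OF assms(2)] by (simp add: has_sum_uminus)
  from has_sum_add[OF sums[OF assms(1)] this]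
  show "(\<Sum>\<^sub>\<infinity>j. a j * tf_shift (z j) f x - b j * tf_shift (z j) f x)
      = (\<Sum>\<^sub>\<infinity>j. a j * tf_shift (z j) f x) - (\<Sum>\<^sub>\<infinity>j. b j * tf_shift (z j) f x)"
    by (simp add: infsumI synth_def)
qed

context
  assumes int_f: "integrable lborel f"
begin

text \<open>Translation preserves the \<open>L\<^sup>1\<close> norm and modulation the modulus, so the terms have norm \<open>|a\<^sub>j|\<close> times that
  of \<open>f\<close>; summability of the coefficients allows the sum and the integral to be exchanged.\<close>

lemma integrable_synth: "rapid_coeffs \<omega> z a \<Longrightarrow> integrable lborel (synth z f a)"
  and fourier_synth: "rapid_coeffs \<omega> z a \<Longrightarrow>
    fourier (synth z f a) \<xi> = (\<Sum>\<^sub>\<infinity>j. a j * exp (\<i> * complex_of_real (fst (z j) \<bullet> snd (z j))) *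
      tf_shift (snd (z j), - fst (z j)) (fourier f) \<xi>)"
proof -
  assume a: "rapid_coeffs \<omega> z a"
  have int: "integrable lborel (\<lambda>x. a j * tf_shift (z j) f x)" for j
    by (intro integrable_mult_right integrable_tf_shift int_f)
  have "(LINT x|lborel. norm (a j * tf_shift (z j) f x)) = cmod (a j) * (LINT x|lborel. cmod (f x))" for j
  proof -
    have "(\<lambda>x. cmod (f x)) \<in> borel_measurable borel"
      using borel_measurable_integrable[OF int_f] by measurable
    from integral_lborel_translate[OF this, of "- fst (z j)"]
    show ?thesis by (simp add: norm_mult norm_tf_shift)
  qed
  moreover have "(\<lambda>j. cmod (a j) * (LINT x|lborel. cmod (f x))) summable_on UNIV"
    using rapid_coeffs_summable[OF a, of 0] by (intro summable_on_cmult_left) simp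
  ultimately have norms: "(\<lambda>j. LINT x|lborel. norm (a j * tf_shift (z j) f x)) summable_on UNIV"
    by simp
  show "integrable lborel (synth z f a)"
    unfolding synth_def[abs_def] by (rule integrable_infsum[OF int synth_abs_summable[OF a] norms])
  have "fourier (synth z f a) \<xi>
      = (LINT x|lborel. (\<Sum>\<^sub>\<infinity>j. a j * tf_shift (z j) f x * exp (- \<i> * complex_of_real (x \<bullet> \<xi>))))"
    by (simp add: fourier_def synth_def infsum_cmult_left')
  also have "\<dots> = (\<Sum>\<^sub>\<infinity>j. fourier (\<lambda>x. a j * tf_shift (z j) f x) \<xi>)"
    unfolding fourier_def
    by (rule integral_infsum[OF integrable_modulated[OF int]])
       (use synth_abs_summable[OF a] norms in \<open>simp_all add: norm_mult\<close>)
  also have "\<dots> = (\<Sum>\<^sub>\<infinity>j. a j * exp (\<i> * complex_of_real (fst (z j) \<bullet> snd (z j))) *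
      tf_shift (snd (z j), - fst (z j)) (fourier f) \<xi>)"
  proof (rule infsum_cong)
    fix j
    show "fourier (\<lambda>x. a j * tf_shift (z j) f x) \<xi> = a j * exp (\<i> * complex_of_real (fst (z j) \<bullet> snd (z j))) *
        tf_shift (snd (z j), - fst (z j)) (fourier f) \<xi>"
      using fourier_tf_shift[OF int_f, of "fst (z j)" "snd (z j)" \<xi>]
      by (simp add: fourier_cmult)
  qed
  finally show "fourier (synth z f a) \<xi> = (\<Sum>\<^sub>\<infinity>j. a j * exp (\<i> * complex_of_real (fst (z j) \<bullet> snd (z j))) *
      tf_shift (snd (z j), - fst (z j)) (fourier f) \<xi>)" .
qed

end

end

end

section \<open>Topologies given by seminorms\<close>

text \<open>The sets \<open>{v \<in> V. p (v - u) < \<epsilon>}\<close> with arbitrary centres \<open>u\<close> form only a subbase. If such a set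
  contains \<open>l\<close>, it contains a ball centred at \<open>l\<close> by the triangle inequality; unions and finite
  intersections follow by induction on the generated topology.\<close>

lemma limitin_seminorm_topology:
  assumes topspace: "topspace (seminorm_topology V P) = V"
    and triangle: "\<And>p u v w. p \<in> P \<Longrightarrow> u \<in> V \<Longrightarrow> v \<in> V \<Longrightarrow> w \<in> V \<Longrightarrow> p (u - w) \<le> p (u - v) + p (v - w)"
    and l: "l \<in> V" and f: "\<And>j. f j \<in> V"
    and lim: "\<And>p \<epsilon>. p \<in> P \<Longrightarrow> \<epsilon> > 0 \<Longrightarrow> \<forall>\<^sub>F j in F. p (f j - l) < \<epsilon>"
  shows "limitin (seminorm_topology V P) f l F"
  unfolding limitin_def topspace
proof (intro conjI allI impI)
  fix U assume "openin (seminorm_topology V P) U \<and> l \<in> U"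
  then have U: "generate_topology_on {{v \<in> V. p (v - u) < \<epsilon>} |u p \<epsilon>. u \<in> V \<and> p \<in> P \<and> \<epsilon> > 0} U"
    and "l \<in> U"
    by (auto simp: seminorm_topology_def openin_topology_generated_by_iff)
  then show "\<forall>\<^sub>F j in F. f j \<in> U"
  proof (induction rule: generate_topology_on.induct)
    case (Int A B)
    then show ?case by (auto elim: eventually_elim2)
  next
    case (UN K)
    then obtain X where "X \<in> K" "l \<in> X" by blast
    with UN.IH[of X] show ?case by (auto elim: eventually_mono)
  next
    case (Basis A)
    then obtain u p \<epsilon> where A: "A = {v \<in> V. p (v - u) < \<epsilon>}" "u \<in> V" "p \<in> P" by auto
    with Basis have "\<epsilon> - p (l - u) > 0" by auto
    from lim[OF A(3) this] show ?case
    proof (rule eventually_mono)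
      fix j assume "p (f j - l) < \<epsilon> - p (l - u)"
      with triangle[OF A(3) f[of j] l A(2)] show "f j \<in> A" by (simp add: A(1) f)
    qed
  qed simp
qed (rule l)

lemma continuous_map_seminorm_topology:
  assumes topspaces: "topspace (seminorm_topology V P) = V" "topspace (seminorm_topology W Q) = W"
    and triangle: "\<And>q u v w. q \<in> Q \<Longrightarrow> u \<in> W \<Longrightarrow> v \<in> W \<Longrightarrow> w \<in> W \<Longrightarrow> q (u - w) \<le> q (u - v) + q (v - w)"
    and zero: "\<And>p c. p \<in> P \<Longrightarrow> c \<in> V \<Longrightarrow> p (c - c) = 0"
    and T: "\<And>c. c \<in> V \<Longrightarrow> T c \<in> W"
    and bounded: "\<And>q. q \<in> Q \<Longrightarrow> \<exists>p\<in>P. \<exists>C\<ge>0. \<forall>c\<in>V. \<forall>c'\<in>V. q (T c' - T c) \<le> C * p (c' - c)"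
  shows "continuous_map (seminorm_topology V P) (seminorm_topology W Q) T"
  unfolding seminorm_topology_def[of W Q]
proof (rule continuous_on_generated_topo)
  show "T ` topspace (seminorm_topology V P) \<subseteq> \<Union> {{v \<in> W. p (v - u) < \<epsilon>} |u p \<epsilon>. u \<in> W \<and> p \<in> Q \<and> \<epsilon> > 0}"
    using T topspaces unfolding seminorm_topology_def[of W Q] topology_generated_by_topspace by blast
  fix U assume "U \<in> {{v \<in> W. p (v - u) < \<epsilon>} |u p \<epsilon>. u \<in> W \<and> p \<in> Q \<and> \<epsilon> > 0}"
  then obtain u q \<epsilon> where U: "U = {v \<in> W. q (v - u) < \<epsilon>}" "u \<in> W" "q \<in> Q" by auto
  obtain p C where pC: "p \<in> P" "C \<ge> 0"
      "\<And>c c'. c \<in> V \<Longrightarrow> c' \<in> V \<Longrightarrow> q (T c' - T c) \<le> C * p (c' - c)"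
    using bounded[OF U(3)] by blast
  have "\<exists>N. openin (seminorm_topology V P) N \<and> c \<in> N \<and> N \<subseteq> T -` U \<inter> V" if c: "c \<in> T -` U \<inter> V" for c
  proof -
    \<comment> \<open>The room that \<open>T c\<close> leaves in the bound defining \<open>U\<close>. Dividing by
      \<open>C + 1\<close> rather than \<open>C\<close> admits \<open>C = 0\<close> and leaves the inequality strict.\<close>
    define r where "r = \<epsilon> - q (T c - u)"
    have r: "r > 0" using c by (simp add: U(1) r_def)
    define N where "N = {c' \<in> V. p (c' - c) < r / (C + 1)}"
    have "openin (seminorm_topology V P) N"
      unfolding seminorm_topology_def N_def
      using c pC r by (intro topology_generated_by_Basis) (auto intro!: exI[of _ c] exI[of _ p] exI[of _ "r / (C + 1)"])
    moreover have "c \<in> N" using c r pC(2) by (simp add: N_def zero[OF pC(1)])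
    moreover have "N \<subseteq> T -` U \<inter> V"
    proof
      fix c' assume "c' \<in> N"
      then have c': "c' \<in> V" "p (c' - c) < r / (C + 1)" by (auto simp: N_def)
      have "q (T c' - u) \<le> q (T c' - T c) + q (T c - u)"
        using c c'(1) by (intro triangle U T) auto
      also have "q (T c' - T c) \<le> C * p (c' - c)" using c c'(1) by (intro pC) auto
      also have "C * p (c' - c) \<le> C * (r / (C + 1))"
        using c'(2) pC(2) by (intro mult_left_mono) auto
      also have "C * (r / (C + 1)) < r" using r pC(2) by (simp add: field_simps)
      finally have "q (T c' - u) < \<epsilon>" by (simp add: r_def)
      then show "c' \<in> T -` U \<inter> V" using c'(1) T by (simp add: U(1))
    qed
    ultimately show ?thesis by blast
  qed
  then have "openin (seminorm_topology V P) (T -` U \<inter> V)"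
    by (subst openin_subopen) blast
  then show "openin (seminorm_topology V P) (T -` U \<inter> topspace (seminorm_topology V P))"
    by (simp add: topspaces)
qed

section \<open>The seminorms of the Beurling space\<close>

lemma S_seminorm_le:
  "(\<And>x. exp (\<mu> * \<omega> (norm x)) * cmod (mderiv \<alpha> f x) \<le> B) \<Longrightarrow> S_seminorm \<omega> \<mu> \<alpha> f \<le> B"
  unfolding S_seminorm_def by (rule cSUP_least) auto

lemma le_S_seminorm:
  assumes "rapidly_decreasing \<omega> f" "\<mu> > 0"
  shows "exp (\<mu> * \<omega> (norm x)) * cmod (mderiv \<alpha> f x) \<le> S_seminorm \<omega> \<mu> \<alpha> f"
  unfolding S_seminorm_def
  by (rule cSUP_upper) (use assms in \<open>auto simp: rapidly_decreasing_iff_mderiv\<close>)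

lemma rapidly_decreasing_diff:
  assumes "rapidly_decreasing \<omega> f" "rapidly_decreasing \<omega> g"
  shows "rapidly_decreasing \<omega> (\<lambda>x. f x - g x)"
  unfolding rapidly_decreasing_def
proof (intro conjI allI impI)
  note smooth = assms[unfolded rapidly_decreasing_def, THEN conjunct1]
  show "C_infinity (\<lambda>x. f x - g x)" by (rule C_infinity_diff[OF smooth])
  fix \<mu> :: real and "is" assume "\<mu> > 0"
  then obtain B1 B2 where B: "\<And>x. exp (\<mu> * \<omega> (norm x)) * cmod (iter_deriv is f x) \<le> B1"
      "\<And>x. exp (\<mu> * \<omega> (norm x)) * cmod (iter_deriv is g x) \<le> B2"
    using assms unfolding rapidly_decreasing_def by blast
  have "exp (\<mu> * \<omega> (norm x)) * cmod (iter_deriv is (\<lambda>x. f x - g x) x) \<le> B1 + B2" for x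
  proof -
    have "exp (\<mu> * \<omega> (norm x)) * cmod (iter_deriv is (\<lambda>x. f x - g x) x)
        \<le> exp (\<mu> * \<omega> (norm x)) * (cmod (iter_deriv is f x) + cmod (iter_deriv is g x))"
      unfolding iter_deriv_diff[OF smooth] by (intro mult_left_mono norm_triangle_ineq4) simp
    also have "\<dots> \<le> B1 + B2" using B[of x] by (simp add: distrib_left)
    finally show ?thesis .
  qed
  then show "\<exists>B. \<forall>x. exp (\<mu> * \<omega> (norm x)) * cmod (iter_deriv is (\<lambda>x. f x - g x) x) \<le> B" by blast
qed

lemma mderiv_diff:
  "C_infinity f \<Longrightarrow> C_infinity g \<Longrightarrow> mderiv \<alpha> (\<lambda>x. f x - g x) = (\<lambda>x. mderiv \<alpha> f x - mderiv \<alpha> g x)"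
  unfolding mderiv_eq_iter_deriv by (rule iter_deriv_diff)

lemma S_seminorm_triangle:
  fixes u v w :: "real^'d::finite \<Rightarrow> complex"
  assumes u: "rapidly_decreasing \<omega> u" and v: "rapidly_decreasing \<omega> v" and w: "rapidly_decreasing \<omega> w"
    and \<mu>: "\<mu> > 0"
  shows "S_seminorm \<omega> \<mu> \<alpha> (\<lambda>x. u x - w x)
    \<le> S_seminorm \<omega> \<mu> \<alpha> (\<lambda>x. u x - v x) + S_seminorm \<omega> \<mu> \<alpha> (\<lambda>x. v x - w x)"
proof (rule S_seminorm_le)
  fix x :: "real^'d"
  note smooth = assms(1-3)[unfolded rapidly_decreasing_def, THEN conjunct1]
  let ?E = "exp (\<mu> * \<omega> (norm x))"
  have "mderiv \<alpha> (\<lambda>x. u x - w x) x = mderiv \<alpha> (\<lambda>x. u x - v x) x + mderiv \<alpha> (\<lambda>x. v x - w x) x"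
    by (simp add: mderiv_diff smooth)
  then have "?E * cmod (mderiv \<alpha> (\<lambda>x. u x - w x) x)
      \<le> ?E * (cmod (mderiv \<alpha> (\<lambda>x. u x - v x) x) + cmod (mderiv \<alpha> (\<lambda>x. v x - w x) x))"
    by (simp add: norm_triangle_ineq)
  also have "\<dots> \<le> S_seminorm \<omega> \<mu> \<alpha> (\<lambda>x. u x - v x) + S_seminorm \<omega> \<mu> \<alpha> (\<lambda>x. v x - w x)"
    unfolding distrib_left
    by (intro add_mono le_S_seminorm rapidly_decreasing_diff u v w \<mu>)
  finally show "?E * cmod (mderiv \<alpha> (\<lambda>x. u x - w x) x)
      \<le> S_seminorm \<omega> \<mu> \<alpha> (\<lambda>x. u x - v x) + S_seminorm \<omega> \<mu> \<alpha> (\<lambda>x. v x - w x)" .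
qed

definition S_seminorms :: "(real \<Rightarrow> real) \<Rightarrow> ((real^'d::finite \<Rightarrow> complex) \<Rightarrow> real) set" where
  "S_seminorms \<omega> = {S_seminorm \<omega> \<mu> \<alpha> | \<mu> \<alpha>. \<mu> > 0} \<union> {\<lambda>u. S_seminorm \<omega> \<mu> \<alpha> (fourier u) | \<mu> \<alpha>. \<mu> > 0}"

lemma S_topology_eq: "S_topology \<omega> = seminorm_topology (S_space \<omega>) (S_seminorms \<omega>)"
  by (simp add: S_topology_def S_seminorms_def)

lemma S_seminorms_triangle:
  assumes p: "p \<in> S_seminorms \<omega>" and S: "u \<in> S_space \<omega>" "v \<in> S_space \<omega>" "w \<in> S_space \<omega>"
  shows "p (u - w) \<le> p (u - v) + p (v - w)"
  using p S_seminorm_triangle S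
  by (auto simp: S_seminorms_def S_space_iff fun_diff_def fourier_diff)

section \<open>The synthesis operator on the Beurling space\<close>

text \<open>The tails of the dominating series tend to \<open>0\<close> along the finite sets of indices, and the bound on the derivatives
  of the remainder is uniform in \<open>x\<close>.\<close>

lemma S_seminorm_synth_tail:
  fixes z :: "'j::countable \<Rightarrow> (real^'d::finite) \<times> (real^'d)"
  assumes \<omega>: "weight_function \<omega>"
    and summable_z: "(\<lambda>j. exp (- real N * \<omega> (norm (z j)))) summable_on UNIV"
    and f: "rapidly_decreasing \<omega> f" and a: "rapid_coeffs \<omega> z a" and "\<mu> > 0" "\<epsilon> > 0"
  shows "\<forall>\<^sub>F F in finite_subsets_at_top UNIV.
    S_seminorm \<omega> \<mu> \<alpha> (\<lambda>x. (\<Sum>j\<in>F. a j * tf_shift (z j) f x) - synth z f a x) < \<epsilon>"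
proof -
  obtain "is" where "is": "\<And>g :: real^'d \<Rightarrow> complex. mderiv \<alpha> g = iter_deriv is g"
    using mderiv_eq_iter_deriv by blast
  obtain B where B: "B summable_on UNIV" "\<And>F x. finite F \<Longrightarrow>
      exp (\<mu> * \<omega> (norm x)) * cmod (iter_deriv is (\<lambda>x. synth z f a x - (\<Sum>j\<in>F. a j * tf_shift (z j) f x)) x)
        \<le> infsum B (- F)"
    using synth_tail[OF \<omega> summable_z f a \<open>\<mu> > 0\<close>] by blast
  have smooth: "C_infinity (synth z f a)" "\<And>F. C_infinity (\<lambda>x. \<Sum>j\<in>F. a j * tf_shift (z j) f x)"
    using rapidly_decreasing_synth[OF \<omega> summable_z f a] f
    by (auto simp: rapidly_decreasing_def intro!: C_infinity_sum C_infinity_cmult_tf_shift)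
  have "((\<lambda>F. sum B F) \<longlongrightarrow> infsum B UNIV) (finite_subsets_at_top UNIV)"
    by (rule infsum_tendsto[OF B(1)])
  then have "\<forall>\<^sub>F F in finite_subsets_at_top UNIV. sum B F > infsum B UNIV - \<epsilon>"
    by (rule order_tendstoD) (use \<open>\<epsilon> > 0\<close> in simp)
  moreover have "\<forall>\<^sub>F F in finite_subsets_at_top (UNIV :: 'j set). finite F"
    by (rule eventually_finite_subsets_at_top_weakI)
  ultimately show ?thesis
  proof eventually_elim
    case (elim F)
    have "infsum B (- F) = infsum B UNIV - sum B F"
      using infsum_Diff[OF B(1), of F] elim(2) by (simp add: Compl_eq_Diff_UNIV)
    moreover have "S_seminorm \<omega> \<mu> \<alpha> (\<lambda>x. (\<Sum>j\<in>F. a j * tf_shift (z j) f x) - synth z f a x) \<le> infsum B (- F)"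
    proof (rule S_seminorm_le)
      fix x
      have "cmod (mderiv \<alpha> (\<lambda>x. (\<Sum>j\<in>F. a j * tf_shift (z j) f x) - synth z f a x) x)
          = cmod (iter_deriv is (\<lambda>x. synth z f a x - (\<Sum>j\<in>F. a j * tf_shift (z j) f x)) x)"
        by (simp add: "is" iter_deriv_diff smooth norm_minus_commute)
      with B(2)[OF elim(2), of x]
      show "exp (\<mu> * \<omega> (norm x)) * cmod (mderiv \<alpha> (\<lambda>x. (\<Sum>j\<in>F. a j * tf_shift (z j) f x) - synth z f a x) x)
          \<le> infsum B (- F)" by simp
    qed
    ultimately show ?case using elim(1) by simp
  qed
qed

lemma S_seminorm_synth_estimate:
  fixes z :: "'j::countable \<Rightarrow> (real^'d::finite) \<times> (real^'d)"
  assumes "weight_function \<omega>"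
    and "(\<lambda>j. exp (- real N * \<omega> (norm (z j)))) summable_on UNIV"
    and "rapidly_decreasing \<omega> f" and "\<mu> > 0"
  shows "\<exists>C\<ge>0. \<exists>K::nat. \<forall>a M. rapid_coeffs \<omega> z a \<longrightarrow>
    (\<forall>j. cmod (a j) * exp (real K * \<omega> (norm (z j))) \<le> M) \<longrightarrow> S_seminorm \<omega> \<mu> \<alpha> (synth z f a) \<le> C * M"
proof -
  obtain "is" where "is": "\<And>g :: real^'d \<Rightarrow> complex. mderiv \<alpha> g = iter_deriv is g"
    using mderiv_eq_iter_deriv by blast
  obtain C and K :: nat where "C \<ge> 0" "\<And>a M x. rapid_coeffs \<omega> z a \<Longrightarrow>
      (\<forall>j. cmod (a j) * exp (real K * \<omega> (norm (z j))) \<le> M) \<Longrightarrow>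
      exp (\<mu> * \<omega> (norm x)) * cmod (iter_deriv is (synth z f a) x) \<le> C * M"
    using synth_estimate[OF assms] by blast
  then show ?thesis
    by (intro exI[of _ C] exI[of _ K] conjI allI impI S_seminorm_le) (auto simp: "is")
qed

text \<open>The points and coefficients of the transformed series. Moduli and norms are unchanged, so all
  hypotheses on the original series hold for the transformed one.\<close>

definition dual_point :: "('j \<Rightarrow> (real^'d::finite) \<times> (real^'d)) \<Rightarrow> 'j \<Rightarrow> (real^'d) \<times> (real^'d)" where
  "dual_point z j = (snd (z j), - fst (z j))"

definition dual_coeffs :: "('j \<Rightarrow> (real^'d::finite) \<times> (real^'d)) \<Rightarrow> ('j \<Rightarrow> complex) \<Rightarrow> 'j \<Rightarrow> complex" where
  "dual_coeffs z a j = a j * exp (\<i> * complex_of_real (fst (z j) \<bullet> snd (z j)))"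

lemma norm_dual_point [simp]: "norm (dual_point z j) = norm (z j)"
  by (simp add: dual_point_def norm_prod_def add.commute)

lemma norm_dual_coeffs [simp]: "cmod (dual_coeffs z a j) = cmod (a j)"
  by (simp add: dual_coeffs_def norm_mult)

context
  fixes \<omega> :: "real \<Rightarrow> real" and N :: nat
    and z :: "'j::countable \<Rightarrow> (real^'d::finite) \<times> (real^'d)"
    and \<psi> :: "real^'d \<Rightarrow> complex"
  assumes \<omega>: "weight_function \<omega>"
    and summable_z: "(\<lambda>j. exp (- real N * \<omega> (norm (z j)))) summable_on UNIV"
    and \<psi>: "\<psi> \<in> S_space \<omega>"
begin

lemma summable_dual: "(\<lambda>j. exp (- real N * \<omega> (norm (dual_point z j)))) summable_on UNIV"
  using summable_z by simp

lemma rapid_dual_coeffs [simp]: "rapid_coeffs \<omega> (dual_point z) (dual_coeffs z a) \<longleftrightarrow> rapid_coeffs \<omega> z a"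
  by (simp add: rapid_coeffs_def)

lemma \<psi>_facts:
  "integrable lborel \<psi>" "rapidly_decreasing \<omega> \<psi>" "rapidly_decreasing \<omega> (fourier \<psi>)"
  using \<psi> by (auto simp: S_space_iff)

lemma fourier_synth_dual:
  assumes "rapid_coeffs \<omega> z a"
  shows "fourier (synth z \<psi> a) = synth (dual_point z) (fourier \<psi>) (dual_coeffs z a)"
  using fourier_synth[OF \<omega> summable_z \<psi>_facts(2,1) assms]
  by (simp add: fun_eq_iff synth_def dual_point_def dual_coeffs_def)

lemma fourier_partial_sum_dual:
  "fourier (\<lambda>x. \<Sum>j\<in>F. a j * tf_shift (z j) \<psi> x)
    = (\<lambda>\<xi>. \<Sum>j\<in>F. dual_coeffs z a j * tf_shift (dual_point z j) (fourier \<psi>) \<xi>)"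
proof -
  have "fourier (\<lambda>x. a j * tf_shift (z j) \<psi> x) \<xi> = dual_coeffs z a j * tf_shift (dual_point z j) (fourier \<psi>) \<xi>"
    for j \<xi>
    using fourier_tf_shift[OF \<psi>_facts(1), of "fst (z j)" "snd (z j)" \<xi>]
    by (simp add: fourier_cmult dual_coeffs_def dual_point_def)
  moreover have "integrable lborel (\<lambda>x. a j * tf_shift (z j) \<psi> x)" for j
    by (intro integrable_mult_right integrable_tf_shift \<psi>_facts)
  ultimately show ?thesis by (simp add: fourier_sum)
qed

lemma synth_in_S_space:
  assumes "rapid_coeffs \<omega> z a"
  shows "synth z \<psi> a \<in> S_space \<omega>"
  using integrable_synth[OF \<omega> summable_z \<psi>_facts(2,1) assms]
    rapidly_decreasing_synth[OF \<omega> summable_z \<psi>_facts(2) assms]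
    rapidly_decreasing_synth[OF \<omega> summable_dual \<psi>_facts(3), of "dual_coeffs z a"] assms
  by (simp add: S_space_iff fourier_synth_dual)

text \<open>A finite sum is the synthesis of coefficients of finite support, which are rapidly decreasing.\<close>

lemma partial_sum_in_S_space:
  assumes "finite F"
  shows "(\<lambda>x. \<Sum>j\<in>F. a j * tf_shift (z j) \<psi> x) \<in> S_space \<omega>"
proof -
  let ?a = "\<lambda>j. if j \<in> F then a j else 0"
  have "rapid_coeffs \<omega> z ?a"
    unfolding rapid_coeffs_def
  proof
    fix k
    have "finite ((\<lambda>j. cmod (?a j) * exp (real k * \<omega> (norm (z j)))) ` UNIV)"
      by (rule finite_subset[of _ "insert 0 ((\<lambda>j. cmod (a j) * exp (real k * \<omega> (norm (z j)))) ` F)"])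
         (use assms in auto)
    then have "bdd_above ((\<lambda>j. cmod (?a j) * exp (real k * \<omega> (norm (z j)))) ` UNIV)"
      by (rule bdd_above_finite)
    then show "\<exists>M. \<forall>j. cmod (?a j) * exp (real k * \<omega> (norm (z j))) \<le> M"
      by (simp add: bdd_above_def)
  qed
  moreover have "synth z \<psi> ?a = (\<lambda>x. \<Sum>j\<in>F. a j * tf_shift (z j) \<psi> x)"
  proof
    fix x
    have "synth z \<psi> ?a x = (\<Sum>\<^sub>\<infinity>j\<in>F. a j * tf_shift (z j) \<psi> x)"
      unfolding synth_def by (rule infsum_cong_neutral) auto
    then show "synth z \<psi> ?a x = (\<Sum>j\<in>F. a j * tf_shift (z j) \<psi> x)" using assms by simp
  qed
  ultimately show ?thesis using synth_in_S_space by metis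
qed

lemma partial_sums_converge:
  assumes "p \<in> S_seminorms \<omega>" "rapid_coeffs \<omega> z a" "\<epsilon> > 0"
  shows "\<forall>\<^sub>F F in finite_subsets_at_top UNIV. p ((\<lambda>x. \<Sum>j\<in>F. a j * tf_shift (z j) \<psi> x) - synth z \<psi> a) < \<epsilon>"
  using assms(1) unfolding S_seminorms_def
proof (elim UnE CollectE exE conjE)
  fix \<mu> :: real and \<alpha> assume "\<mu> > 0" "p = S_seminorm \<omega> \<mu> \<alpha>"
  then show ?thesis
    using S_seminorm_synth_tail[OF \<omega> summable_z \<psi>_facts(2) assms(2) \<open>\<mu> > 0\<close> assms(3), of \<alpha>]
    by (simp add: fun_diff_def)
next
  fix \<mu> :: real and \<alpha> assume "\<mu> > 0" and p: "p = (\<lambda>u. S_seminorm \<omega> \<mu> \<alpha> (fourier u))"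
  have "\<forall>\<^sub>F F in finite_subsets_at_top (UNIV :: 'j set). finite F"
    by (rule eventually_finite_subsets_at_top_weakI)
  with S_seminorm_synth_tail[OF \<omega> summable_dual \<psi>_facts(3) _ \<open>\<mu> > 0\<close> assms(3), of "dual_coeffs z a" \<alpha>] assms(2)
  have "\<forall>\<^sub>F F in finite_subsets_at_top UNIV. S_seminorm \<omega> \<mu> \<alpha> (\<lambda>\<xi>.
      (\<Sum>j\<in>F. dual_coeffs z a j * tf_shift (dual_point z j) (fourier \<psi>) \<xi>)
        - synth (dual_point z) (fourier \<psi>) (dual_coeffs z a) \<xi>) < \<epsilon> \<and> finite F"
    by (simp add: eventually_conj_iff)
  then show ?thesis
  proof (rule eventually_mono, elim conjE)
    fix F :: "'j set" assume "finite F"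
    then have "integrable lborel (\<lambda>x. \<Sum>j\<in>F. a j * tf_shift (z j) \<psi> x)"
      using partial_sum_in_S_space by (auto simp: S_space_iff)
    moreover have "integrable lborel (synth z \<psi> a)"
      using synth_in_S_space[OF assms(2)] by (simp add: S_space_iff)
    ultimately have *: "fourier ((\<lambda>x. \<Sum>j\<in>F. a j * tf_shift (z j) \<psi> x) - synth z \<psi> a)
      = (\<lambda>\<xi>. (\<Sum>j\<in>F. dual_coeffs z a j * tf_shift (dual_point z j) (fourier \<psi>) \<xi>)
        - synth (dual_point z) (fourier \<psi>) (dual_coeffs z a) \<xi>)"
      by (simp add: fun_diff_def fourier_diff fourier_partial_sum_dual fourier_synth_dual assms(2))
    assume "S_seminorm \<omega> \<mu> \<alpha> (\<lambda>\<xi>.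
      (\<Sum>j\<in>F. dual_coeffs z a j * tf_shift (dual_point z j) (fourier \<psi>) \<xi>)
        - synth (dual_point z) (fourier \<psi>) (dual_coeffs z a) \<xi>) < \<epsilon>"
    then show "p ((\<lambda>x. \<Sum>j\<in>F. a j * tf_shift (z j) \<psi> x) - synth z \<psi> a) < \<epsilon>"
      unfolding p * .
  qed
qed

lemma seminorm_synth_estimate:
  assumes "p \<in> S_seminorms \<omega>"
  shows "\<exists>C\<ge>0. \<exists>K::nat. \<forall>a M. rapid_coeffs \<omega> z a \<longrightarrow>
    (\<forall>j. cmod (a j) * exp (real K * \<omega> (norm (z j))) \<le> M) \<longrightarrow> p (synth z \<psi> a) \<le> C * M"
  using assms unfolding S_seminorms_def
proof (elim UnE CollectE exE conjE)
  fix \<mu> :: real and \<alpha> assume "\<mu> > 0" "p = S_seminorm \<omega> \<mu> \<alpha>"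
  then show ?thesis using S_seminorm_synth_estimate[OF \<omega> summable_z \<psi>_facts(2)] by simp
next
  fix \<mu> :: real and \<alpha> assume "\<mu> > 0" and p: "p = (\<lambda>u. S_seminorm \<omega> \<mu> \<alpha> (fourier u))"
  obtain C and K :: nat where C: "C \<ge> 0" "\<And>a M. rapid_coeffs \<omega> (dual_point z) a \<Longrightarrow>
      (\<forall>j. cmod (a j) * exp (real K * \<omega> (norm (dual_point z j))) \<le> M) \<Longrightarrow>
      S_seminorm \<omega> \<mu> \<alpha> (synth (dual_point z) (fourier \<psi>) a) \<le> C * M"
    using S_seminorm_synth_estimate[OF \<omega> summable_dual \<psi>_facts(3) \<open>\<mu> > 0\<close>, of \<alpha>] by blast
  have "p (synth z \<psi> a) \<le> C * M" if "rapid_coeffs \<omega> z a"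
      "\<forall>j. cmod (a j) * exp (real K * \<omega> (norm (z j))) \<le> M" for a M
    using C(2)[of "dual_coeffs z a" M] that by (simp add: p fourier_synth_dual)
  with C(1) show ?thesis by blast
qed

end

section \<open>Continuity of the synthesis operator\<close>

lemma le_seq_norm:
  assumes "c \<in> seq_space \<omega> \<Lambda>" "\<sigma> \<in> \<Lambda>"
  shows "cmod (c \<sigma>) * exp (real k * \<omega> (norm \<sigma>)) \<le> seq_norm \<omega> \<Lambda> k c"
  unfolding seq_norm_def by (rule cSUP_upper) (use assms in \<open>auto simp: seq_space_def\<close>)

lemma seq_space_diff:
  assumes "c \<in> seq_space \<omega> \<Lambda>" "c' \<in> seq_space \<omega> \<Lambda>"
  shows "c' - c \<in> seq_space \<omega> \<Lambda>"
  unfolding seq_space_def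
proof (intro CollectI conjI allI impI)
  show "(c' - c) \<sigma> = 0" if "\<sigma> \<notin> \<Lambda>" for \<sigma>
    using assms that by (simp add: seq_space_def del: split_paired_All)
  fix k :: nat
  have "cmod ((c' - c) \<sigma>) * exp (real k * \<omega> (norm \<sigma>)) \<le> seq_norm \<omega> \<Lambda> k c' + seq_norm \<omega> \<Lambda> k c"
    if "\<sigma> \<in> \<Lambda>" for \<sigma>
  proof -
    have "cmod ((c' - c) \<sigma>) * exp (real k * \<omega> (norm \<sigma>))
        \<le> (cmod (c' \<sigma>) + cmod (c \<sigma>)) * exp (real k * \<omega> (norm \<sigma>))"
      by (intro mult_right_mono) (simp_all add: norm_triangle_ineq4)
    also have "\<dots> \<le> seq_norm \<omega> \<Lambda> k c' + seq_norm \<omega> \<Lambda> k c"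
      unfolding distrib_right by (intro add_mono le_seq_norm assms that)
    finally show ?thesis .
  qed
  then show "bdd_above ((\<lambda>\<sigma>. cmod ((c' - c) \<sigma>) * exp (real k * \<omega> (norm \<sigma>))) ` \<Lambda>)"
    by (rule bdd_aboveI2)
qed

theorem proposition2p10:
  fixes \<omega> :: "real \<Rightarrow> real" and \<alpha>\<^sub>0 \<beta>\<^sub>0 :: real and \<psi> :: "real^'d \<Rightarrow> complex"
  assumes "weight_function \<omega>"
    and "\<alpha>\<^sub>0 > 0" and "\<beta>\<^sub>0 > 0"
    and "gabor_frame (gaussian :: real^'d \<Rightarrow> complex) (lattice \<alpha>\<^sub>0 \<beta>\<^sub>0)"
    and "\<psi> \<in> S_space \<omega>" and "\<psi> \<noteq> (\<lambda>_. 0)"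
  shows "(\<forall>c \<in> seq_space \<omega> (lattice \<alpha>\<^sub>0 \<beta>\<^sub>0).
            synthesis \<alpha>\<^sub>0 \<beta>\<^sub>0 \<psi> c \<in> S_space \<omega> \<and>
            limitin (S_topology \<omega>) (synthesis_partial \<alpha>\<^sub>0 \<beta>\<^sub>0 \<psi> c) (synthesis \<alpha>\<^sub>0 \<beta>\<^sub>0 \<psi> c)
              (finite_subsets_at_top UNIV))
       \<and> continuous_map (seq_topology \<omega> (lattice \<alpha>\<^sub>0 \<beta>\<^sub>0)) (S_topology \<omega>) (synthesis \<alpha>\<^sub>0 \<beta>\<^sub>0 \<psi>)"
proof -
  let ?\<Lambda> = "lattice \<alpha>\<^sub>0 \<beta>\<^sub>0 :: ((real^'d) \<times> (real^'d)) set"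
  let ?z = "lattice_point \<alpha>\<^sub>0 \<beta>\<^sub>0 :: (int^'d) \<times> (int^'d) \<Rightarrow> (real^'d) \<times> (real^'d)"
  obtain N :: nat where summable: "(\<lambda>j. exp (- real N * \<omega> (norm (?z j)))) summable_on UNIV"
    using summable_on_lattice_weight[OF assms(1-3)] by blast
  note setting = assms(1) summable assms(5)
  have \<psi>: "rapidly_decreasing \<omega> \<psi>" using assms(5) by (simp add: S_space_iff)
  have z: "?z j \<in> ?\<Lambda>" for j by (simp add: lattice_def)
  have coeffs: "rapid_coeffs \<omega> ?z (\<lambda>j. c (?z j))" if "c \<in> seq_space \<omega> ?\<Lambda>" for c
    using le_seq_norm[OF that z] unfolding rapid_coeffs_def by blast
  have synthesis_eq: "synthesis \<alpha>\<^sub>0 \<beta>\<^sub>0 \<psi> c = synth ?z \<psi> (\<lambda>j. c (?z j))" for c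
    by (simp add: fun_eq_iff synthesis_def synth_def)
  have in_S: "synthesis \<alpha>\<^sub>0 \<beta>\<^sub>0 \<psi> c \<in> S_space \<omega>" if "c \<in> seq_space \<omega> ?\<Lambda>" for c
    unfolding synthesis_eq by (rule synth_in_S_space[OF setting coeffs[OF that]])
  have topspace_S: "topspace (seminorm_topology (S_space \<omega>) (S_seminorms \<omega>)) = (S_space \<omega> :: (real^'d \<Rightarrow> complex) set)"
    using topspace_S_topology by (simp add: S_topology_eq)
  have topspace_seq: "topspace (seminorm_topology (seq_space \<omega> ?\<Lambda>) (range (seq_norm \<omega> ?\<Lambda>))) = seq_space \<omega> ?\<Lambda>"
    using topspace_seq_topology by (simp add: seq_topology_def)
  show ?thesis
  proof (intro conjI ballI)
    fix c assume c: "c \<in> seq_space \<omega> ?\<Lambda>"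
    show "synthesis \<alpha>\<^sub>0 \<beta>\<^sub>0 \<psi> c \<in> S_space \<omega>" by (rule in_S[OF c])
    have partial: "synthesis_partial \<alpha>\<^sub>0 \<beta>\<^sub>0 \<psi> c F = (\<lambda>x. \<Sum>j\<in>F. c (?z j) * tf_shift (?z j) \<psi> x)" for F
      by (simp add: fun_eq_iff synthesis_partial_def)
    show "limitin (S_topology \<omega>) (synthesis_partial \<alpha>\<^sub>0 \<beta>\<^sub>0 \<psi> c) (synthesis \<alpha>\<^sub>0 \<beta>\<^sub>0 \<psi> c) (finite_subsets_at_top UNIV)"
      unfolding S_topology_eq
    proof (rule limitin_seminorm_topology[OF topspace_S S_seminorms_triangle in_S[OF c]])
      show "synthesis_partial \<alpha>\<^sub>0 \<beta>\<^sub>0 \<psi> c F \<in> S_space \<omega>" for F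
      proof (cases "finite F")
        case True
        then show ?thesis unfolding partial by (rule partial_sum_in_S_space[OF setting])
      next
        \<comment> \<open>A sum over an infinite set of indices is \<open>0\<close> by convention, hence equal to the empty one.\<close>
        case False
        then show ?thesis
          unfolding partial using partial_sum_in_S_space[OF setting finite.emptyI] by simp
      qed
    next
      fix p :: "(real^'d \<Rightarrow> complex) \<Rightarrow> real" and \<epsilon> assume "p \<in> S_seminorms \<omega>" "(\<epsilon>::real) > 0"
      then show "\<forall>\<^sub>F F in finite_subsets_at_top UNIV. p (synthesis_partial \<alpha>\<^sub>0 \<beta>\<^sub>0 \<psi> c F - synthesis \<alpha>\<^sub>0 \<beta>\<^sub>0 \<psi> c) < \<epsilon>"
        unfolding partial synthesis_eq by (intro partial_sums_converge[OF setting _ coeffs[OF c]])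
    qed
  next
    show "continuous_map (seq_topology \<omega> ?\<Lambda>) (S_topology \<omega>) (synthesis \<alpha>\<^sub>0 \<beta>\<^sub>0 \<psi>)"
      unfolding S_topology_eq seq_topology_def
    proof (rule continuous_map_seminorm_topology[OF topspace_seq topspace_S S_seminorms_triangle _ in_S])
      show "p (c - c) = 0" if "p \<in> range (seq_norm \<omega> ?\<Lambda>)" for p c
        using that z by (auto simp: seq_norm_def lattice_def)
      fix q :: "(real^'d \<Rightarrow> complex) \<Rightarrow> real" assume "q \<in> S_seminorms \<omega>"
      then obtain C and K :: nat where C: "C \<ge> 0" "\<And>a M. rapid_coeffs \<omega> ?z a \<Longrightarrow>
          (\<forall>j. cmod (a j) * exp (real K * \<omega> (norm (?z j))) \<le> M) \<Longrightarrow> q (synth ?z \<psi> a) \<le> C * M"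
        using seminorm_synth_estimate[OF setting] by blast
      have "q (synthesis \<alpha>\<^sub>0 \<beta>\<^sub>0 \<psi> c' - synthesis \<alpha>\<^sub>0 \<beta>\<^sub>0 \<psi> c) \<le> C * seq_norm \<omega> ?\<Lambda> K (c' - c)"
        if c: "c \<in> seq_space \<omega> ?\<Lambda>" and c': "c' \<in> seq_space \<omega> ?\<Lambda>" for c c'
      proof -
        have "synthesis \<alpha>\<^sub>0 \<beta>\<^sub>0 \<psi> c' - synthesis \<alpha>\<^sub>0 \<beta>\<^sub>0 \<psi> c = synth ?z \<psi> (\<lambda>j. (c' - c) (?z j))"
          unfolding synthesis_eq
          using synth_diff[OF assms(1) summable \<psi> coeffs[OF c'] coeffs[OF c]] by (simp add: fun_diff_def)
        with C(2)[OF coeffs[OF seq_space_diff[OF c c']], of "seq_norm \<omega> ?\<Lambda> K (c' - c)"]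
        show ?thesis using le_seq_norm[OF seq_space_diff[OF c c'] z] by simp
      qed
      with C(1) show "\<exists>p\<in>range (seq_norm \<omega> ?\<Lambda>). \<exists>C\<ge>0. \<forall>c\<in>seq_space \<omega> ?\<Lambda>. \<forall>c'\<in>seq_space \<omega> ?\<Lambda>.
          q (synthesis \<alpha>\<^sub>0 \<beta>\<^sub>0 \<psi> c' - synthesis \<alpha>\<^sub>0 \<beta>\<^sub>0 \<psi> c) \<le> C * p (c' - c)"
        by blast
    qed
  qed
qed

end
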